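(* For any formula $\phi(\mathbf{x},\mathbf{y})$, writing $d=\mathrm{VCd}(\phi)$, we have $\mathrm{VCd}(\phi)=\mathrm{VCd}_{\mathrm{ind}}(\phi)$ if and only if $\phi$ traces an infinite $d$-maximum set system, i.e. if and only if there are an infinite set $A\subseteq\mathrm{M}^{|\mathbf{y}|}$ and a family $\mathcal{C}\subseteq S_\phi(A)$ which is $d$-maximum on $A$.
   Context: Fix a complete first-order theory $T$ with a large saturated (monster, in particular infinite) model $\mathfrak{M}$ with universe $\mathrm{M}$. Formulas are partitioned, $\phi(\mathbf{x},\mathbf{y})$, with $\mathbf{x}=\langle x_1,\ldots,x_l\rangle$ and $\mathbf{y}=\langle y_1,\ldots,y_k\rangle$ finite nonempty tuples of variables; $|\mathbf{x}|=l$, $|\mathbf{y}|=k$. For $A\subseteq \mathrm{M}^{|\mathbf{y}|}$, $S_\phi(A)$ is the set of $\phi$-types over $A$, i.e. maximal consistent sets of formulas of the form $\pm\phi(\mathbf{x},\mathbf{a})$, $\mathbf{a}\in A$. A type $p\in S_\phi(A)$ is identified with the subset $\{\mathbf{a}\in A:\phi(\mathbf{x},\mathbf{a})\in p\}$ of $A$, so $S_\phi(A)\subseteq\mathcal{P}(A)$. The formula $\phi$ traces a set system $\mathcal{C}$ if $\mathcal{C}\subseteq S_\phi(A)$ for some $A\subseteq\mathrm{M}^{|\mathbf{y}|}$. Maximum set systems: for a set $X$, $\mathcal{C}\subseteq\mathcal{P}(X)$ and $A\subseteq X$, let $\mathcal{C}|^A=\{C\cap A: C\in\mathcal{C}\}$.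 For $d\in\omega$, $\mathcal{C}$ is $d$-maximum (on $X$) if for every finite $A\subseteq X$, $|\mathcal{C}|^A|=\binom{|A|}{\leq d}$, where $\binom{n}{\leq k}$ denotes $\sum_{i=0}^k\binom{n}{i}$ if $k<n$ and $2^n$ otherwise. Convention: $\infty$-maximum means $\mathcal{C}|^A=\mathcal{P}(A)$ for every finite $A\subseteq X$; if $d$ is finite but not a non-negative integer, no set system is $d$-maximum. For $r\in\mathbb{R}$, $\mathrm{VCd}(\phi)\leq r$ means: there is $K\in\omega$ such that for every nonempty finite $A\subseteq\mathrm{M}^{|\mathbf{y}|}$, $|S_\phi(A)|<K\cdot|A|^r$. And $\mathrm{VCd}_{\mathrm{ind}}(\phi)\leq r$ means: there is $K\in\omega$ such that for every nonempty finite indiscernible sequence $\bar{\mathbf{b}}=\langle\mathbf{b}_i:i<N\rangle$ of elements of $\mathrm{M}^{|\mathbf{y}|}$, $|S_\phi(\mathrm{range}(\bar{\mathbf{b}}))|<K\cdot N^r$. $\mathrm{VCd}(\phi)$ and $\mathrm{VCd}_{\mathrm{ind}}(\phi)$ are the infima of the respective admissible $r$, and are $\infty$ if there is none. *)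

theory Defs
  imports "HOL-Library.Extended_Real"
begin

unbundle cardinal_syntax

text \<open>A symbol is a name together with its arity.\<close>

record ('f, 'r) language =
  funs :: "('f \<times> nat) set"
  rels :: "('r \<times> nat) set"

datatype 'f tm = Var nat | Fun 'f "'f tm list"

datatype ('f, 'r) fm =
    Eq "'f tm" "'f tm"
  | Rel 'r "'f tm list"
  | Neg "('f, 'r) fm"
  | Conj "('f, 'r) fm" "('f, 'r) fm"
  | Exists nat "('f, 'r) fm"

fun wf_tm :: "('f, 'r) language \<Rightarrow> 'f tm \<Rightarrow> bool" where
  "wf_tm L (Var v) \<longleftrightarrow> True"
| "wf_tm L (Fun f ts) \<longleftrightarrow> (f, length ts) \<in> funs L \<and> (\<forall>t\<in>set ts. wf_tm L t)"

fun wf_fm :: "('f, 'r) language \<Rightarrow> ('f, 'r) fm \<Rightarrow> bool" where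
  "wf_fm L (Eq s t) \<longleftrightarrow> wf_tm L s \<and> wf_tm L t"
| "wf_fm L (Rel R ts) \<longleftrightarrow> (R, length ts) \<in> rels L \<and> (\<forall>t\<in>set ts. wf_tm L t)"
| "wf_fm L (Neg \<psi>) \<longleftrightarrow> wf_fm L \<psi>"
| "wf_fm L (Conj \<psi> \<chi>) \<longleftrightarrow> wf_fm L \<psi> \<and> wf_fm L \<chi>"
| "wf_fm L (Exists v \<psi>) \<longleftrightarrow> wf_fm L \<psi>"

fun tm_vars :: "'f tm \<Rightarrow> nat set" where
  "tm_vars (Var v) = {v}"
| "tm_vars (Fun f ts) = (\<Union>t\<in>set ts. tm_vars t)"

fun free_vars :: "('f, 'r) fm \<Rightarrow> nat set" where
  "free_vars (Eq s t) = tm_vars s \<union> tm_vars t"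
| "free_vars (Rel R ts) = (\<Union>t\<in>set ts. tm_vars t)"
| "free_vars (Neg \<psi>) = free_vars \<psi>"
| "free_vars (Conj \<psi> \<chi>) = free_vars \<psi> \<union> free_vars \<chi>"
| "free_vars (Exists v \<psi>) = free_vars \<psi> - {v}"

definition sentences :: "('f, 'r) language \<Rightarrow> ('f, 'r) fm set" where
  "sentences L = {\<sigma>. wf_fm L \<sigma> \<and> free_vars \<sigma> = {}}"

text \<open>The universe of a structure is the whole type \<^typ>\<open>'a\<close>. Values of the interpretation
  at argument lists whose length is not an arity of the symbol in the language at hand are never
  used by well-formed formulas.\<close>

record ('f, 'r, 'a) fo_structure =
  fun_interp :: "'f \<Rightarrow> 'a list \<Rightarrow> 'a"
  rel_interp :: "'r \<Rightarrow> 'a list \<Rightarrow> bool"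

fun eval_tm :: "('f, 'r, 'a) fo_structure \<Rightarrow> (nat \<Rightarrow> 'a) \<Rightarrow> 'f tm \<Rightarrow> 'a" where
  "eval_tm M e (Var v) = e v"
| "eval_tm M e (Fun f ts) = fun_interp M f (map (eval_tm M e) ts)"

fun sat :: "('f, 'r, 'a) fo_structure \<Rightarrow> (nat \<Rightarrow> 'a) \<Rightarrow> ('f, 'r) fm \<Rightarrow> bool" where
  "sat M e (Eq s t) \<longleftrightarrow> eval_tm M e s = eval_tm M e t"
| "sat M e (Rel R ts) \<longleftrightarrow> rel_interp M R (map (eval_tm M e) ts)"
| "sat M e (Neg \<psi>) \<longleftrightarrow> \<not> sat M e \<psi>"
| "sat M e (Conj \<psi> \<chi>) \<longleftrightarrow> sat M e \<psi> \<and> sat M e \<chi>"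
| "sat M e (Exists v \<psi>) \<longleftrightarrow> (\<exists>a. sat M (e(v := a)) \<psi>)"

definition models :: "('f, 'r, 'a) fo_structure \<Rightarrow> ('f, 'r) fm set \<Rightarrow> bool" where
  "models M T \<longleftrightarrow> (\<forall>\<sigma>\<in>T. \<forall>e. sat M e \<sigma>)"

text \<open>Theories are taken to be deductively closed, so completeness is membership of every sentence
  or its negation. Consistency is not part of the definition; it follows from having a model.\<close>

definition complete_theory :: "('f, 'r) language \<Rightarrow> ('f, 'r) fm set \<Rightarrow> bool" where
  "complete_theory L T \<longleftrightarrow>
     T \<subseteq> sentences L \<and> (\<forall>\<sigma>\<in>sentences L. \<sigma> \<in> T \<or> Neg \<sigma> \<in> T)"

text \<open>A formula \<open>\<psi>(v, a\<^sub>1, \<dots>, a\<^sub>m)\<close> with parameters from \<^term>\<open>A\<close>, in the single object variable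
  \<open>0\<close>, is a pair \<open>(\<psi>, e)\<close> where \<open>e\<close> sends the remaining free variables of \<open>\<psi>\<close> into \<^term>\<open>A\<close>.
  Saturation says that every finitely satisfiable set of such formulas over fewer than
  \<open>|M|\<close> parameters is realised.\<close>

definition saturated :: "('f, 'r) language \<Rightarrow> ('f, 'r, 'a) fo_structure \<Rightarrow> bool" where
  "saturated L M \<longleftrightarrow>
     (\<forall>A :: 'a set. |A| <o |UNIV :: 'a set| \<longrightarrow>
        (\<forall>p. (\<forall>(\<psi>, e)\<in>p. wf_fm L \<psi> \<and> e ` (free_vars \<psi> - {0}) \<subseteq> A) \<longrightarrow>
             (\<forall>q\<subseteq>p. finite q \<longrightarrow> (\<exists>c. \<forall>(\<psi>, e)\<in>q. sat M (e(0 := c)) \<psi>)) \<longrightarrow>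
             (\<exists>c. \<forall>(\<psi>, e)\<in>p. sat M (e(0 := c)) \<psi>)))"

text \<open>``Large'' is read as: of cardinality greater than the number of formulas of the language
  (which already makes the structure infinite).\<close>

definition monster :: "('f, 'r) language \<Rightarrow> ('f, 'r, 'a) fo_structure \<Rightarrow> bool" where
  "monster L M \<longleftrightarrow>
     infinite (UNIV :: 'a set) \<and>
     |{\<psi>. wf_fm L \<psi>}| <o |UNIV :: 'a set| \<and>
     saturated L M"

definition tuples :: "nat \<Rightarrow> 'a list set" where
  "tuples n = {a. length a = n}"

definition partitioned ::
    "('f, 'r) language \<Rightarrow> ('f, 'r) fm \<Rightarrow> nat list \<Rightarrow> nat list \<Rightarrow> bool" where
  "partitioned L \<phi> x y \<longleftrightarrow>
     wf_fm L \<phi> \<and> x \<noteq> [] \<and> y \<noteq> [] \<and> distinct (x @ y) \<and> free_vars \<phi> \<subseteq> set (x @ y)"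

definition assign :: "nat list \<Rightarrow> 'a list \<Rightarrow> nat \<Rightarrow> 'a" where
  "assign vs as v = (case map_of (zip vs as) v of Some a \<Rightarrow> a | None \<Rightarrow> undefined)"

text \<open>\<open>holds M \<phi> x y c b\<close> is \<open>M \<Turnstile> \<phi>(c, b)\<close>.\<close>

definition holds ::
    "('f, 'r, 'a) fo_structure \<Rightarrow> ('f, 'r) fm \<Rightarrow> nat list \<Rightarrow> nat list \<Rightarrow> 'a list \<Rightarrow> 'a list \<Rightarrow> bool"
  where
  "holds M \<phi> x y c b \<longleftrightarrow> sat M (assign (x @ y) (c @ b)) \<phi>"

text \<open>The pair \<open>(True, a)\<close> stands for the formula \<open>\<phi>(x, a)\<close> and \<open>(False, a)\<close> for
  \<open>\<not> \<phi>(x, a)\<close>. Consistent means consistent with the elementary diagram of the monster model,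
  i.e. finitely satisfiable in it.\<close>

definition consistent ::
    "('f, 'r, 'a) fo_structure \<Rightarrow> ('f, 'r) fm \<Rightarrow> nat list \<Rightarrow> nat list \<Rightarrow> (bool \<times> 'a list) set \<Rightarrow> bool"
  where
  "consistent M \<phi> x y p \<longleftrightarrow>
     (\<forall>q\<subseteq>p. finite q \<longrightarrow> (\<exists>c\<in>tuples (length x). \<forall>(s, a)\<in>q. holds M \<phi> x y c a \<longleftrightarrow> s))"

definition phi_type ::
    "('f, 'r, 'a) fo_structure \<Rightarrow> ('f, 'r) fm \<Rightarrow> nat list \<Rightarrow> nat list \<Rightarrow>
     'a list set \<Rightarrow> (bool \<times> 'a list) set \<Rightarrow> bool" where
  "phi_type M \<phi> x y A p \<longleftrightarrow>
     p \<subseteq> UNIV \<times> A \<and> consistent M \<phi> x y p \<and>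
     (\<forall>q. p \<subseteq> q \<and> q \<subseteq> UNIV \<times> A \<and> consistent M \<phi> x y q \<longrightarrow> q = p)"

text \<open>The space \<open>S\<^sub>\<phi>(A)\<close>, each type being identified with a subset of \<^term>\<open>A\<close>.\<close>

definition types_over ::
    "('f, 'r, 'a) fo_structure \<Rightarrow> ('f, 'r) fm \<Rightarrow> nat list \<Rightarrow> nat list \<Rightarrow> 'a list set \<Rightarrow> 'a list set set"
  where
  "types_over M \<phi> x y A = {{a \<in> A. (True, a) \<in> p} | p. phi_type M \<phi> x y A p}"

text \<open>The formula \<^term>\<open>\<psi>\<close> has free variables among \<^term>\<open>zs\<close>, which splits into blocks of \<^term>\<open>k\<close>
  variables, one for each entry of the strictly increasing index list.\<close>

definition indiscernible ::
    "('f, 'r) language \<Rightarrow> ('f, 'r, 'a) fo_structure \<Rightarrow> nat \<Rightarrow> 'a list list \<Rightarrow> bool" where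
  "indiscernible L M k bs \<longleftrightarrow>
     set bs \<subseteq> tuples k \<and>
     (\<forall>\<psi> zs is js.
        wf_fm L \<psi> \<and> distinct zs \<and> free_vars \<psi> \<subseteq> set zs \<and>
        length js = length is \<and> length zs = k * length is \<and>
        sorted_wrt (<) is \<and> set is \<subseteq> {..<length bs} \<and>
        sorted_wrt (<) js \<and> set js \<subseteq> {..<length bs} \<longrightarrow>
        (sat M (assign zs (concat (map (\<lambda>i. bs ! i) is))) \<psi> \<longleftrightarrow>
         sat M (assign zs (concat (map (\<lambda>j. bs ! j) js))) \<psi>))"

definition VCd_le ::
    "('f, 'r, 'a) fo_structure \<Rightarrow> ('f, 'r) fm \<Rightarrow> nat list \<Rightarrow> nat list \<Rightarrow> real \<Rightarrow> bool" where
  "VCd_le M \<phi> x y r \<longleftrightarrow>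
     (\<exists>K :: nat. \<forall>A \<subseteq> tuples (length y). finite A \<and> A \<noteq> {} \<longrightarrow>
        real (card (types_over M \<phi> x y A)) < real K * real (card A) powr r)"

definition VCd_ind_le ::
    "('f, 'r) language \<Rightarrow> ('f, 'r, 'a) fo_structure \<Rightarrow> ('f, 'r) fm \<Rightarrow> nat list \<Rightarrow> nat list \<Rightarrow> real \<Rightarrow> bool"
  where
  "VCd_ind_le L M \<phi> x y r \<longleftrightarrow>
     (\<exists>K :: nat. \<forall>bs. bs \<noteq> [] \<and> indiscernible L M (length y) bs \<longrightarrow>
        real (card (types_over M \<phi> x y (set bs))) < real K * real (length bs) powr r)"

text \<open>In \<^typ>\<open>ereal\<close> the infimum of the empty set is \<open>\<infinity>\<close>.\<close>

definition VCd ::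
    "('f, 'r, 'a) fo_structure \<Rightarrow> ('f, 'r) fm \<Rightarrow> nat list \<Rightarrow> nat list \<Rightarrow> ereal" where
  "VCd M \<phi> x y = Inf {ereal r | r. VCd_le M \<phi> x y r}"

definition VCd_ind ::
    "('f, 'r) language \<Rightarrow> ('f, 'r, 'a) fo_structure \<Rightarrow> ('f, 'r) fm \<Rightarrow> nat list \<Rightarrow> nat list \<Rightarrow> ereal"
  where
  "VCd_ind L M \<phi> x y = Inf {ereal r | r. VCd_ind_le L M \<phi> x y r}"

definition trace :: "'b set set \<Rightarrow> 'b set \<Rightarrow> 'b set set" where
  "trace \<C> A = (\<lambda>C. C \<inter> A) ` \<C>"

definition choose_le :: "nat \<Rightarrow> nat \<Rightarrow> nat" where
  "choose_le n k = (if k < n then \<Sum>i=0..k. n choose i else 2 ^ n)"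

definition maximum_on :: "ereal \<Rightarrow> 'b set \<Rightarrow> 'b set set \<Rightarrow> bool" where
  "maximum_on d X \<C> \<longleftrightarrow>
     \<C> \<subseteq> Pow X \<and>
     ((\<exists>n :: nat. d = ereal (real n) \<and>
          (\<forall>A \<subseteq> X. finite A \<longrightarrow> card (trace \<C> A) = choose_le (card A) n)) \<or>
      (d = \<infinity> \<and> (\<forall>A \<subseteq> X. finite A \<longrightarrow> trace \<C> A = Pow A)))"

definition traces_infinite_maximum ::
    "('f, 'r, 'a) fo_structure \<Rightarrow> ('f, 'r) fm \<Rightarrow> nat list \<Rightarrow> nat list \<Rightarrow> ereal \<Rightarrow> bool" where
  "traces_infinite_maximum M \<phi> x y d \<longleftrightarrow>
     (\<exists>A \<subseteq> tuples (length y). infinite A \<and>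
        (\<exists>\<C> \<subseteq> types_over M \<phi> x y A. maximum_on d A \<C>))"

end

theory Submission
  imports Defs "HOL-Library.Sublist" "HOL-Library.Ramsey"
begin

text \<open>Along an indiscernible sequence the set of traces of \<open>\<phi>\<close> depends only
  on the number of entries, so it is a set of binary words closed under subwords. A word of \<open>d +
  1\<close> letters \<open>s\<^sub>0 \<dots> s\<^sub>d\<close> describes an automaton: in state
  \<open>i\<close> the letter \<open>s\<^sub>i\<close> is read without moving, the other letter leads
  to state \<open>i + 1\<close>, and leaving the last state rejects. By Pascal's rule it accepts
  exactly \<open>\<Sum>i\<le>d. n choose i\<close> words of length \<open>n\<close>, and its language
  is closed under subwords, so the accepted words form a \<open>d\<close>-maximum system. Conversely,
  if no automaton with \<open>n + 2\<close> states has its language realised on arbitrarily long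
  indiscernible sequences, then the realised words omit one subsequence for each automaton, which
  leaves only \<open>O(N\<^sup>n)\<close> words of length \<open>N\<close>. Hence the density on
  indiscernible sequences is the largest \<open>n\<close> for which some automaton with \<open>n +
  1\<close> states is realised on arbitrarily long indiscernible sequences (or
  \<open>\<infinity>\<close>), and compactness yields an infinite \<open>n\<close>-maximum system. In
  the other direction, Ramsey's theorem and compactness turn an infinite \<open>d\<close>-maximum
  system into arbitrarily long indiscernible sequences with at least \<open>\<Sum>i\<le>d. N choose
  i\<close> types.\<close>

section \<open>Words\<close>

text \<open>The automaton searches greedily for the word \<open>map Not s\<close>, and
  \<open>[]\<close> is the state in which the search has succeeded. So \<open>accepts s w\<close>
  says that \<open>map Not s\<close> is not a subsequence of \<open>w\<close>.\<close>

fun accepts :: "bool list \<Rightarrow> bool list \<Rightarrow> bool" where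
  "accepts [] w \<longleftrightarrow> False"
| "accepts (a # s) [] \<longleftrightarrow> True"
| "accepts (a # s) (l # w) \<longleftrightarrow> (if l = a then accepts (a # s) w else accepts s w)"

lemma accepts_Nil_iff [simp]: "accepts s [] \<longleftrightarrow> s \<noteq> []"
  by (cases s) auto

lemma accepts_Cons_state: "accepts s w \<Longrightarrow> accepts (a # s) w"
proof (induction w arbitrary: a s)
  case (Cons l w)
  obtain b r where s: "s = b # r"
    using Cons.prems by (cases s) auto
  have "accepts s w"
    using Cons s by (auto split: if_splits)
  then show ?case
    using Cons.IH by auto
qed simp

lemma accepts_tl: "accepts s (l # w) \<Longrightarrow> accepts s w"
  by (cases s) (auto split: if_splits intro: accepts_Cons_state)

lemma accepts_subseq: "subseq v w \<Longrightarrow> accepts s w \<Longrightarrow> accepts s v"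
proof (induction v w arbitrary: s rule: list_emb.induct)
  case (list_emb_Nil w)
  then show ?case by (cases s) auto
next
  case (list_emb_Cons v w l)
  then show ?case by (blast intro: accepts_tl)
next
  case (list_emb_Cons2 l l' v w)
  then show ?case by (cases s) (auto split: if_splits)
qed

lemma accepts_all: "length w < length s \<Longrightarrow> accepts s w"
proof (induction w arbitrary: s)
  case (Cons l w)
  then show ?case
    by (cases s) (auto intro: accepts_Cons_state)
qed auto

text \<open>The state reached after \<open>w\<close> has a letter on which it loops, and repeating
  this letter never rejects. This pads accepted words to any prescribed length.\<close>

lemma accepts_append_replicate: "accepts s w \<Longrightarrow> \<exists>a. \<forall>m. accepts s (w @ replicate m a)"
proof (induction s w rule: accepts.induct)
  case (2 a s)
  have "accepts (a # s) (replicate m a)" for m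
    by (induction m) auto
  then show ?case by auto
qed (auto split: if_splits)

text \<open>Outside \<open>B\<close> the letter inserted is the one on which the current state
  loops, so only the letters of \<open>v\<close> move the automaton. With
  \<open>accepts_subseq\<close>, the restrictions of accepted words to \<open>B\<close> are exactly
  the accepted words of that length.\<close>

lemma accepts_fill:
  "accepts s v \<Longrightarrow> length v = length (nths xs B) \<Longrightarrow>
     \<exists>w. length w = length xs \<and> accepts s w \<and> nths w B = v"
proof (induction xs arbitrary: s v B)
  case (Cons x xs)
  let ?B = "{j. Suc j \<in> B}"
  obtain a r where s: "s = a # r"
    using Cons.prems by (cases s) auto
  show ?case
  proof (cases "0 \<in> B")
    case True
    then obtain l v' where v: "v = l # v'"
      using Cons.prems by (cases v) (auto simp: nths_Cons)
    let ?s = "if l = a then s else r"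
    have "accepts ?s v'" "length v' = length (nths xs ?B)"
      using Cons.prems s v True by (auto simp: nths_Cons)
    then obtain w where "length w = length xs" "accepts ?s w" "nths w ?B = v'"
      using Cons.IH by blast
    then have "length (l # w) = length (x # xs) \<and> accepts s (l # w) \<and> nths (l # w) B = v"
      using True s v by (auto simp: nths_Cons split: if_splits)
    then show ?thesis by blast
  next
    case False
    then obtain w where "length w = length xs" "accepts s w" "nths w ?B = v"
      using Cons.IH[of s v ?B] Cons.prems by (auto simp: nths_Cons)
    then have "length (a # w) = length (x # xs) \<and> accepts s (a # w) \<and> nths (a # w) B = v"
      using False s by (auto simp: nths_Cons)
    then show ?thesis by blast
  qed
qed auto

lemma finite_words: "finite {w :: bool list. length w = n \<and> Q w}"
  by (rule finite_subset[OF _ finite_lists_length_eq[of "UNIV :: bool set" n]]) auto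

lemma card_words: "card {w :: bool list. length w = n} = 2 ^ n"
  using card_lists_length_eq[of "UNIV :: bool set" n] by simp

text \<open>Pascal's rule, by the first letter: either \<open>s\<close> or its tail has to accept
  the rest. The count depends on the length of \<open>s\<close> alone.\<close>

lemma card_accepts:
  "card {w. length w = n \<and> accepts s w} = (\<Sum>i<length s. n choose i)"
proof (induction n arbitrary: s)
  case 0
  have "{w. length w = 0 \<and> accepts s w} = (if s = [] then {} else {[]})"
    by (cases s) auto
  moreover have "(\<Sum>i<Suc m. 0 choose i) = 1" for m
    by (subst sum.lessThan_Suc_shift) simp
  ultimately show ?case
    by (cases s) (auto simp del: sum.lessThan_Suc)
next
  case (Suc n)
  show ?case
  proof (cases s)
    case (Cons a r)
    have "{w. length w = Suc n \<and> accepts s w} =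
      Cons a ` {w. length w = n \<and> accepts s w} \<union> Cons (\<not> a) ` {w. length w = n \<and> accepts r w}"
      using Cons by (auto simp: length_Suc_conv split: if_splits)
    then have "card {w. length w = Suc n \<and> accepts s w} =
      (\<Sum>i<length s. n choose i) + (\<Sum>i<length r. n choose i)"
      using Suc by (subst \<open>_ = _ \<union> _\<close>, subst card_Un_disjoint)
        (auto simp: card_image finite_words)
    also have "\<dots> = (\<Sum>i<length s. Suc n choose i)"
      using Cons by (simp add: sum.lessThan_Suc_shift sum.distrib del: sum.lessThan_Suc)
    finally show ?thesis .
  qed simp
qed

text \<open>The binomial coefficients with \<open>i > n\<close> vanish, so both cases of the
  definition become the sum that counts the words accepted with \<open>d + 1\<close> states.\<close>

lemma choose_le_eq: "choose_le n d = (\<Sum>i<Suc d. n choose i)"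
proof (cases "d < n")
  case True
  then show ?thesis
    by (simp add: choose_le_def atLeast0AtMost lessThan_Suc_atMost)
next
  case False
  then have "(\<Sum>i<Suc d. n choose i) = (\<Sum>i\<le>n. n choose i)"
    by (intro sum.mono_neutral_right) auto
  then show ?thesis
    using False by (simp add: choose_le_def choose_row_sum)
qed

section \<open>Words that contain every short accepted word\<close>

text \<open>Each state contributes \<open>k\<close> copies of its loop letter, and the letter that
  moves on separates the blocks. A word that omits some accepted word of length at most
  \<open>k\<close> must omit this single word.\<close>

fun rich_word :: "nat \<Rightarrow> bool list \<Rightarrow> bool list" where
  "rich_word k [] = []"
| "rich_word k (a # s) = replicate k a @ (if s = [] then [] else (\<not> a) # rich_word k s)"

text \<open>The induction needs a first block that is partly used up: \<open>i\<close> counts its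
  remaining letters. A loop letter consumes one of them; the other letter moves to the next block,
  which is full again.\<close>

lemma subseq_rich_word_aux:
  assumes "accepts (a # s) w" "length w \<le> i" "i \<le> k"
  shows "subseq w (replicate i a @ (if s = [] then [] else (\<not> a) # rich_word k s))"
  using assms
proof (induction w arbitrary: i a s)
  case (Cons l w)
  then obtain i' where i: "i = Suc i'" "length w \<le> i'"
    by (cases i) auto
  show ?case
  proof (cases "l = a")
    case True
    then have "accepts (a # s) w" "i' \<le> k"
      using Cons.prems i by auto
    then show ?thesis
      using Cons.IH[of a s i'] i True by simp
  next
    case False
    then obtain b r where s: "s = b # r" "accepts s w"
      using Cons.prems by (cases s) auto
    then have "subseq w (rich_word k s)"
      using Cons.IH[of b r k] Cons.prems i by simp
    then show ?thesis
      using False s by (auto intro!: list_emb_append2)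
  qed
qed simp

lemma subseq_rich_word: "accepts s w \<Longrightarrow> length w \<le> k \<Longrightarrow> subseq w (rich_word k s)"
  using subseq_rich_word_aux[of _ _ w k k] by (cases s) auto

section \<open>Polynomial bounds for recursively bounded counts\<close>

text \<open>The index is the degree plus one, so that \<open>0\<close> can stand for eventual vanishing.\<close>

fun growth :: "nat \<Rightarrow> (nat \<Rightarrow> nat) \<Rightarrow> bool" where
  "growth 0 f \<longleftrightarrow> (\<exists>n0. \<forall>n\<ge>n0. f n = 0)"
| "growth (Suc d) f \<longleftrightarrow> (\<exists>C. \<forall>n. f n \<le> C * (n + 1) ^ d)"

lemma growth_Suc:
  assumes "growth d f"
  shows "growth (Suc d) f"
proof (cases d)
  case 0
  then obtain n0 where n0: "\<And>n. n \<ge> n0 \<Longrightarrow> f n = 0"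
    using assms by auto
  have "f n \<le> (\<Sum>i<n0. f i)" for n
    using n0 by (cases "n < n0") (auto intro: member_le_sum)
  then show ?thesis
    using 0 by auto
next
  case (Suc d')
  then obtain C where C: "\<And>n. f n \<le> C * (n + 1) ^ d'"
    using assms by auto
  have "f n \<le> C * (n + 1) ^ d" for n
  proof -
    have "C * (n + 1) ^ d' \<le> C * (n + 1) ^ d"
      unfolding Suc by (intro mult_left_mono power_increasing) auto
    then show ?thesis
      using C[of n] by linarith
  qed
  then show ?thesis by auto
qed

text \<open>The bound on \<open>h\<close> refers to \<open>f\<close> and \<open>g\<close> only,
  never to \<open>h\<close> itself, so nothing accumulates and the degree is kept.\<close>

lemma growth_add:
  assumes "growth d f" "growth d g" "\<And>n. h (Suc n) \<le> f n + g n"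
  shows "growth d h"
proof (cases d)
  case 0
  then obtain n0 n1 where "\<And>n. n \<ge> n0 \<Longrightarrow> f n = 0" "\<And>n. n \<ge> n1 \<Longrightarrow> g n = 0"
    using assms by auto
  then have "h n = 0" if "n \<ge> Suc (max n0 n1)" for n
    using assms(3)[of "n - 1"] that by (cases n) auto
  then show ?thesis
    using 0 by auto
next
  case (Suc d')
  then obtain C C' where C: "\<And>n. f n \<le> C * (n + 1) ^ d'" "\<And>n. g n \<le> C' * (n + 1) ^ d'"
    using assms by auto
  have "h n \<le> (C + C' + h 0) * (n + 1) ^ d'" for n
  proof (cases n)
    case (Suc m)
    have "h n \<le> C * (m + 1) ^ d' + C' * (m + 1) ^ d'"
      using assms(3)[of m] C[of m] Suc add_mono order_trans by meson
    also have "\<dots> \<le> (C + C' + h 0) * (m + 1) ^ d'"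
      by (simp add: algebra_simps)
    also have "\<dots> \<le> (C + C' + h 0) * (n + 1) ^ d'"
      using Suc by (intro mult_left_mono power_mono) auto
    finally show ?thesis .
  qed simp
  then show ?thesis
    using Suc by auto
qed

text \<open>Unfolding the recursion bounds \<open>f n\<close> by \<open>f 0\<close> plus a sum of
  \<open>n\<close> values of \<open>g\<close>, which costs one degree; if \<open>g\<close> vanishes
  eventually, the sum is bounded.\<close>

lemma growth_sum:
  assumes "growth d g" "\<And>n. f (Suc n) \<le> f n + g n"
  shows "growth (Suc d) f"
proof -
  have sum: "f n \<le> f 0 + (\<Sum>i<n. g i)" for n
  proof (induction n)
    case (Suc n)
    then show ?case
      using assms(2)[of n] by simp
  qed simp
  show ?thesis
  proof (cases d)
    case 0
    then obtain n0 where n0: "\<And>n. n \<ge> n0 \<Longrightarrow> g n = 0"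
      using assms by auto
    have "(\<Sum>i<n. g i) \<le> (\<Sum>i<n0. g i)" for n
    proof -
      have "(\<Sum>i<n. g i) = (\<Sum>i\<in>{..<n} \<inter> {..<n0}. g i)"
        using n0 by (intro sum.mono_neutral_right) (auto simp: not_less[symmetric])
      also have "\<dots> \<le> (\<Sum>i<n0. g i)"
        by (intro sum_mono2) auto
      finally show ?thesis .
    qed
    then have "f n \<le> (f 0 + (\<Sum>i<n0. g i)) * (n + 1) ^ 0" for n
      using sum[of n] by (simp add: add_left_mono order_trans)
    then show ?thesis
      using 0 by (auto intro: exI)
  next
    case (Suc d')
    then obtain C where C: "\<And>n. g n \<le> C * (n + 1) ^ d'"
      using assms by auto
    have "f n \<le> (f 0 + C) * (n + 1) ^ d" for n
    proof -
      have "(\<Sum>i<n. g i) \<le> (\<Sum>i<n. C * (n + 1) ^ d')"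
      proof (intro sum_mono order_trans[OF C])
        fix i assume "i \<in> {..<n}"
        then show "C * (i + 1) ^ d' \<le> C * (n + 1) ^ d'"
          by (intro mult_left_mono power_mono) auto
      qed
      also have "\<dots> \<le> C * (n + 1) ^ d"
        unfolding Suc by simp
      finally have "f n \<le> f 0 * 1 + C * (n + 1) ^ d"
        using sum[of n] by linarith
      also have "\<dots> \<le> f 0 * (n + 1) ^ d + C * (n + 1) ^ d"
        by (intro add_mono mult_left_mono) auto
      finally show ?thesis
        by (simp add: algebra_simps)
    qed
    then show ?thesis by auto
  qed
qed

section \<open>Counting the words that omit all rich words\<close>

text \<open>The counters \<open>i\<close> and \<open>j\<close> say how many letters \<open>False\<close> and \<open>True\<close> are still missing from
  the first block.\<close>

definition poor_words :: "nat \<Rightarrow> nat \<Rightarrow> nat \<Rightarrow> nat \<Rightarrow> nat \<Rightarrow> bool list set" where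
  "poor_words k m i j n = {u. length u = n \<and>
     (\<forall>a s. length s = m \<longrightarrow> \<not> subseq (replicate (if a then j else i) a @
        (if s = [] then [] else (\<not> a) # rich_word k s)) u)}"

lemma finite_poor_words [simp]: "finite (poor_words k m i j n)"
  by (simp add: poor_words_def finite_words)

text \<open>With full counters nothing of the first block has been matched: the situation on
  entering a new block, and the one that realised words satisfy.\<close>

lemma poor_words_start:
  "poor_words k m k k n = {u. length u = n \<and> (\<forall>s. length s = Suc m \<longrightarrow> \<not> subseq (rich_word k s) u)}"
proof -
  have *: "(\<forall>s. length s = Suc m \<longrightarrow> Q s) \<longleftrightarrow> (\<forall>a s. length s = m \<longrightarrow> Q (a # s))" for Q
    by (auto simp: length_Suc_conv)
  show ?thesis
    unfolding poor_words_def * by simp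
qed

text \<open>Reading \<open>l\<close> can match one letter of a first block made of \<open>l\<close>
  and leaves the other first block as it was, so at most one counter drops.\<close>

lemma poor_words_Cons_same:
  assumes "l # u \<in> poor_words k m i j (Suc n)"
  shows "u \<in> poor_words k m (if l then i else i - 1) (if l then j - 1 else j) n"
proof -
  define t where "t a s = (if s = [] then [] else (\<not> a) # rich_word k s)" for a s
  have *: "\<not> subseq (replicate (if a then j else i) a @ t a s) (l # u)" if "length s = m" for a s
    using assms that by (auto simp: poor_words_def t_def)
  have "\<not> subseq (replicate (if a then (if l then j - 1 else j) else if l then i else i - 1) a @ t a s) u"
    if "length s = m" for a s
  proof
    assume sub: "subseq (replicate (if a then (if l then j - 1 else j) else if l then i else i - 1) a @ t a s) u"
    have "subseq (replicate (if a then j else i) a @ t a s) (l # u)"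
    proof (cases "a = l \<and> (if a then j else i) > 0")
      case True
      then show ?thesis
        using sub by (cases "if a then j else i") (auto split: if_splits)
    next
      case False
      then show ?thesis
        using sub by (auto split: if_splits)
    qed
    then show False
      using * that by blast
  qed
  then show ?thesis
    using assms by (auto simp: poor_words_def t_def)
qed

text \<open>With \<open>m = 0\<close> the omitted patterns are powers of one letter, so a poor word
  has fewer than \<open>i\<close> letters \<open>False\<close> and fewer than \<open>j\<close>
  letters \<open>True\<close>.\<close>

lemma poor_words_growth_0: "growth 0 (\<lambda>n. card (poor_words k 0 i j n))"
proof -
  have "length u < i + j" if "u \<in> poor_words k 0 i j (length u)" for u
    using that
  proof (induction u arbitrary: i j)
    case Nil
    then show ?case by (cases i; cases j) (auto simp: poor_words_def)
  next
    case (Cons l u)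
    have "\<not> subseq (replicate (if a then j else i) a) (l # u)" for a
      using Cons.prems by (auto simp: poor_words_def)
    from this[of True] this[of False] have "i > 0" "j > 0"
      by (auto intro!: Nat.gr0I)
    moreover have "length u < (if l then i else i - 1) + (if l then j - 1 else j)"
      using Cons.prems by (intro Cons.IH poor_words_Cons_same) simp
    ultimately show ?case
      by (auto split: if_splits)
  qed
  then have "poor_words k 0 i j n = {}" if "n \<ge> i + j" for n
    using that by (fastforce simp: poor_words_def)
  then show ?thesis
    by (auto intro!: exI[of _ "i + j"])
qed

text \<open>When the block of \<open>\<not> l\<close> is complete, \<open>l\<close> is exactly the
  separator that follows it, so what remains must omit every rich word with one block fewer.\<close>

lemma poor_words_Cons_next:
  assumes "l # u \<in> poor_words k (Suc m) i j (Suc n)" "(if l then i else j) = 0"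
  shows "u \<in> poor_words k m k k n"
proof -
  have "\<not> subseq (rich_word k s) u" if "length s = Suc m" for s
  proof
    assume "subseq (rich_word k s) u"
    moreover have "\<not> subseq (replicate (if \<not> l then j else i) (\<not> l) @
        (if s = [] then [] else (\<not> \<not> l) # rich_word k s)) (l # u)"
      using assms(1) that unfolding poor_words_def by blast
    ultimately show False
      using assms(2) that by (cases l; cases s) (auto simp del: rich_word.simps)
  qed
  then show ?thesis
    using assms by (simp add: poor_words_start) (simp add: poor_words_def)
qed

text \<open>Split off the first letter. While both counters are positive, either letter lowers one
  of them. When a single counter is zero, one letter keeps the counters and the other starts the
  next block; this recursion is a summation and raises the degree by one.\<close>

lemma poor_words_growth: "growth m (\<lambda>n. card (poor_words k m i j n))"
proof (induction m arbitrary: i j)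
  case 0
  show ?case by (rule poor_words_growth_0)
next
  case (Suc m)
  let ?P = "\<lambda>i j n. poor_words k (Suc m) i j n"
  let ?Q = "poor_words k m k k"
  have split: "card (?P i j (Suc n)) \<le> card X + card Y"
    if "finite X" "finite Y"
      "\<And>u. False # u \<in> ?P i j (Suc n) \<Longrightarrow> u \<in> X" "\<And>u. True # u \<in> ?P i j (Suc n) \<Longrightarrow> u \<in> Y"
    for X Y i j n
  proof -
    have "?P i j (Suc n) \<subseteq> Cons False ` X \<union> Cons True ` Y"
    proof
      fix w assume w: "w \<in> ?P i j (Suc n)"
      then obtain l u where "w = l # u"
        by (auto simp: poor_words_def length_Suc_conv)
      then show "w \<in> Cons False ` X \<union> Cons True ` Y"
        using w that(3,4) by (cases l) auto
    qed
    then have "card (?P i j (Suc n)) \<le> card (Cons False ` X \<union> Cons True ` Y)"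
      using that by (intro card_mono) auto
    also have "\<dots> \<le> card X + card Y"
      by (rule order_trans[OF card_Un_le]) (use that in \<open>auto intro!: add_mono card_image_le\<close>)
    finally show ?thesis .
  qed
  show ?case
  proof (induction "i + j" arbitrary: i j rule: less_induct)
    case less
    note same = poor_words_Cons_same[of _ _ k "Suc m" i j]
    note nxt = poor_words_Cons_next[of _ _ k m i j]
    consider "i = 0" "j = 0" | "i = 0" "j > 0" | "i > 0" "j = 0" | "i > 0" "j > 0"
      by auto
    then show ?case
    proof cases
      case 1
      have "card (?P i j (Suc n)) \<le> card (?Q n) + card (?Q n)" for n
        by (rule split) (use 1 nxt in auto)
      then show ?thesis
        by (rule growth_add[OF growth_Suc[OF Suc] growth_Suc[OF Suc]])
    next
      case 2
      have "card (?P i j (Suc n)) \<le> card (?P i j n) + card (?Q n)" for n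
        by (rule split) (use 2 nxt[of True] same[of False] in auto)
      then show ?thesis
        by (rule growth_sum[OF Suc])
    next
      case 3
      have "card (?P i j (Suc n)) \<le> card (?Q n) + card (?P i j n)" for n
        by (rule split) (use 3 nxt[of False] same[of True] in auto)
      then have "card (?P i j (Suc n)) \<le> card (?P i j n) + card (?Q n)" for n
        by (simp add: add.commute)
      then show ?thesis
        by (rule growth_sum[OF Suc])
    next
      case 4
      have "card (?P i j (Suc n)) \<le> card (?P (i - 1) j n) + card (?P i (j - 1) n)" for n
        by (rule split) (use 4 same[of False] same[of True] in auto)
      then show ?thesis
        using 4 by (intro growth_add[OF less[of "i - 1" j] less[of i "j - 1"]]) auto
    qed
  qed
qed

section \<open>Definable predicates and compactness\<close>

lemma eval_tm_cong: "(\<And>v. v \<in> tm_vars t \<Longrightarrow> e v = e' v) \<Longrightarrow> eval_tm M e t = eval_tm M e' t"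
proof (induction t)
  case (Fun f ts)
  then have "map (eval_tm M e) ts = map (eval_tm M e') ts"
    by auto
  then show ?case
    by (simp del: map_eq_conv)
qed simp

lemma sat_cong: "(\<And>v. v \<in> free_vars \<psi> \<Longrightarrow> e v = e' v) \<Longrightarrow> sat M e \<psi> \<longleftrightarrow> sat M e' \<psi>"
proof (induction \<psi> arbitrary: e e')
  case (Eq s t)
  then show ?case
    using eval_tm_cong[of s e e' M] eval_tm_cong[of t e e' M] by simp
next
  case (Rel r ts)
  then have "map (eval_tm M e) ts = map (eval_tm M e') ts"
    by (auto intro!: eval_tm_cong)
  then show ?case
    by (simp del: map_eq_conv)
next
  case (Neg \<psi>)
  have "sat M e \<psi> \<longleftrightarrow> sat M e' \<psi>"
    by (rule Neg.IH) (rule Neg.prems, simp)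
  then show ?case
    by simp
next
  case (Conj \<psi> \<chi>)
  have "sat M e \<psi> \<longleftrightarrow> sat M e' \<psi>"
    by (rule Conj.IH) (rule Conj.prems, simp)
  moreover have "sat M e \<chi> \<longleftrightarrow> sat M e' \<chi>"
    by (rule Conj.IH) (rule Conj.prems, simp)
  ultimately show ?case
    by simp
next
  case (Exists v \<psi>)
  then have "sat M (e(v := a)) \<psi> \<longleftrightarrow> sat M (e'(v := a)) \<psi>" for a
    by (intro Exists.IH) auto
  then show ?case by simp
qed

lemma finite_tm_vars: "finite (tm_vars t)"
  by (induction t) auto

lemma finite_free_vars: "finite (free_vars \<psi>)"
  by (induction \<psi>) (auto simp: finite_tm_vars)

fun rename_tm :: "(nat \<Rightarrow> nat) \<Rightarrow> 'f tm \<Rightarrow> 'f tm" where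
  "rename_tm f (Var v) = Var (f v)"
| "rename_tm f (Fun g ts) = Fun g (map (rename_tm f) ts)"

lemma wf_rename_tm: "wf_tm L t \<Longrightarrow> wf_tm L (rename_tm f t)"
  by (induction t) auto

lemma tm_vars_rename_tm: "tm_vars (rename_tm f t) = f ` tm_vars t"
  by (induction t) auto

lemma eval_rename_tm: "eval_tm M e (rename_tm f t) = eval_tm M (\<lambda>v. e (f v)) t"
proof (induction t)
  case (Fun g ts)
  then have "map (eval_tm M e) (map (rename_tm f) ts) = map (eval_tm M (\<lambda>v. e (f v))) ts"
    by simp
  then show ?case
    by (metis eval_tm.simps(2) rename_tm.simps(2))
qed simp

text \<open>\<open>f\<close> need not be injective, so a bound variable could be captured; the
  quantifier case first moves it outside the image of the free variables under
  \<open>f\<close>.\<close>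

lemma ex_rename_fm:
  assumes "wf_fm L \<psi>"
  shows "\<exists>\<psi>'. wf_fm L \<psi>' \<and> free_vars \<psi>' \<subseteq> f ` free_vars \<psi> \<and>
           (\<forall>e. sat M e \<psi>' \<longleftrightarrow> sat M (\<lambda>v. e (f v)) \<psi>)"
  using assms
proof (induction \<psi> arbitrary: f)
  case (Eq s t)
  then show ?case
    by (intro exI[of _ "Eq (rename_tm f s) (rename_tm f t)"])
      (auto simp: wf_rename_tm tm_vars_rename_tm eval_rename_tm)
next
  case (Rel r ts)
  have "map (eval_tm M e) (map (rename_tm f) ts) = map (eval_tm M (\<lambda>v. e (f v))) ts" for e
    by (simp add: eval_rename_tm)
  then have "sat M e (Rel r (map (rename_tm f) ts)) \<longleftrightarrow> sat M (\<lambda>v. e (f v)) (Rel r ts)" for e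
    by (metis sat.simps(2))
  then show ?case
    using Rel by (intro exI[of _ "Rel r (map (rename_tm f) ts)"])
      (auto simp: wf_rename_tm tm_vars_rename_tm simp del: sat.simps)
next
  case (Neg \<psi>)
  then obtain \<psi>' where "wf_fm L \<psi>'" "free_vars \<psi>' \<subseteq> f ` free_vars \<psi>"
      "\<And>e. sat M e \<psi>' \<longleftrightarrow> sat M (\<lambda>v. e (f v)) \<psi>"
    by (metis wf_fm.simps(3))
  then show ?case
    by (intro exI[of _ "Neg \<psi>'"]) auto
next
  case (Conj \<psi> \<chi>)
  obtain \<psi>' where "wf_fm L \<psi>'" "free_vars \<psi>' \<subseteq> f ` free_vars \<psi>"
      "\<And>e. sat M e \<psi>' \<longleftrightarrow> sat M (\<lambda>v. e (f v)) \<psi>"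
    using Conj.IH(1) Conj.prems by (metis wf_fm.simps(4))
  moreover obtain \<chi>' where "wf_fm L \<chi>'" "free_vars \<chi>' \<subseteq> f ` free_vars \<chi>"
      "\<And>e. sat M e \<chi>' \<longleftrightarrow> sat M (\<lambda>v. e (f v)) \<chi>"
    using Conj.IH(2) Conj.prems by (metis wf_fm.simps(4))
  ultimately show ?case
    by (intro exI[of _ "Conj \<psi>' \<chi>'"]) auto
next
  case (Exists v \<psi>)
  obtain u where u: "u \<notin> f ` free_vars \<psi>"
    using ex_new_if_finite[of "f ` free_vars \<psi>"] finite_free_vars by blast
  obtain \<psi>' where \<psi>': "wf_fm L \<psi>'" "free_vars \<psi>' \<subseteq> (f(v := u)) ` free_vars \<psi>"
      "\<And>e. sat M e \<psi>' \<longleftrightarrow> sat M (\<lambda>w. e ((f(v := u)) w)) \<psi>"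
    using Exists.IH[of "f(v := u)"] Exists.prems by auto
  have "sat M (e(u := a)) \<psi>' \<longleftrightarrow> sat M ((\<lambda>v. e (f v))(v := a)) \<psi>" for e a
    unfolding \<psi>' by (rule sat_cong) (use u in auto)
  then show ?case
    using \<psi>' by (intro exI[of _ "Exists u \<psi>'"]) auto
qed

section \<open>Closure properties of definable predicates\<close>

text \<open>Working with definable predicates on assignments instead of formulas keeps substitution and
  bound variables out of the later arguments.\<close>

definition definable ::
    "('f, 'r) language \<Rightarrow> ('f, 'r, 'a) fo_structure \<Rightarrow> nat set \<Rightarrow> ((nat \<Rightarrow> 'a) \<Rightarrow> bool) \<Rightarrow> bool" where
  "definable L M V R \<longleftrightarrow> (\<exists>\<psi>. wf_fm L \<psi> \<and> free_vars \<psi> \<subseteq> V \<and> (\<forall>e. sat M e \<psi> \<longleftrightarrow> R e))"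

lemma definableE:
  assumes "definable L M V R"
  obtains \<psi> where "wf_fm L \<psi>" "free_vars \<psi> \<subseteq> V" "\<And>e. sat M e \<psi> \<longleftrightarrow> R e"
  using assms by (auto simp: definable_def)

lemma definable_sat: "wf_fm L \<psi> \<Longrightarrow> free_vars \<psi> \<subseteq> V \<Longrightarrow> definable L M V (\<lambda>e. sat M e \<psi>)"
  by (auto simp: definable_def)

lemma definable_cong:
  assumes "definable L M V R" "\<And>v. v \<in> V \<Longrightarrow> e v = e' v"
  shows "R e \<longleftrightarrow> R e'"
proof -
  obtain \<psi> where "free_vars \<psi> \<subseteq> V" "\<And>e. sat M e \<psi> \<longleftrightarrow> R e"
    using assms(1) unfolding definable_def by blast
  then show ?thesis
    using sat_cong[of \<psi> e e' M] assms(2) by auto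
qed

lemma definable_mono: "definable L M V R \<Longrightarrow> V \<subseteq> V' \<Longrightarrow> definable L M V' R"
  by (auto simp: definable_def)

lemma definable_finite_vars:
  assumes "definable L M V R"
  obtains V' where "finite V'" "V' \<subseteq> V" "definable L M V' R"
  using assms unfolding definable_def by (metis finite_free_vars order_refl)

lemma definable_rename: "definable L M V R \<Longrightarrow> f ` V \<subseteq> V' \<Longrightarrow> definable L M V' (\<lambda>e. R (\<lambda>v. e (f v)))"
proof (erule definableE)
  fix \<psi>
  assume fV: "f ` V \<subseteq> V'" and \<psi>: "wf_fm L \<psi>" "free_vars \<psi> \<subseteq> V" "\<And>e. sat M e \<psi> \<longleftrightarrow> R e"
  obtain \<psi>' where \<psi>': "wf_fm L \<psi>'" "free_vars \<psi>' \<subseteq> f ` free_vars \<psi>"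
      "\<And>e. sat M e \<psi>' \<longleftrightarrow> sat M (\<lambda>v. e (f v)) \<psi>"
    using ex_rename_fm[OF \<psi>(1)] by metis
  have "free_vars \<psi>' \<subseteq> V'"
    using \<psi>'(2) \<psi>(2) fV by blast
  then show "definable L M V' (\<lambda>e. R (\<lambda>v. e (f v)))"
    unfolding definable_def using \<psi>'(1,3) \<psi>(3) by auto
qed

lemma definable_Not:
  assumes "definable L M V R"
  shows "definable L M V (\<lambda>e. \<not> R e)"
proof -
  obtain \<psi> where "wf_fm L \<psi>" "free_vars \<psi> \<subseteq> V" "\<And>e. sat M e \<psi> \<longleftrightarrow> R e"
    using assms unfolding definable_def by blast
  then show ?thesis
    unfolding definable_def by (intro exI[of _ "Neg \<psi>"]) auto
qed

lemma definable_conj: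
  assumes "definable L M V R" "definable L M V Q"
  shows "definable L M V (\<lambda>e. R e \<and> Q e)"
proof -
  obtain \<psi> where "wf_fm L \<psi>" "free_vars \<psi> \<subseteq> V" "\<And>e. sat M e \<psi> \<longleftrightarrow> R e"
    using assms(1) unfolding definable_def by blast
  moreover obtain \<chi> where "wf_fm L \<chi>" "free_vars \<chi> \<subseteq> V" "\<And>e. sat M e \<chi> \<longleftrightarrow> Q e"
    using assms(2) unfolding definable_def by blast
  ultimately show ?thesis
    unfolding definable_def by (intro exI[of _ "Conj \<psi> \<chi>"]) auto
qed

lemma definable_disj:
  assumes "definable L M V R" "definable L M V Q"
  shows "definable L M V (\<lambda>e. R e \<or> Q e)"
  using definable_Not[OF definable_conj[OF definable_Not definable_Not]] assms by fastforce

lemma definable_True: "definable L M V (\<lambda>e. True)"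
  unfolding definable_def by (intro exI[of _ "Exists 0 (Eq (Var 0) (Var 0))"]) auto

lemma definable_const: "definable L M V (\<lambda>e. Q)"
  using definable_True[of L M V] definable_Not[OF definable_True[of L M V]] by (cases Q) auto

text \<open>\<open>Q\<close> is arbitrary because \<open>I\<close> is finite: deciding one index at
  a time gives a Boolean combination of the \<open>R i\<close>. This makes conditions on the number
  of true \<open>R i\<close> definable.\<close>

lemma definable_Collect:
  assumes "finite I" "\<And>i. i \<in> I \<Longrightarrow> definable L M V (R i)"
  shows "definable L M V (\<lambda>e. Q {i \<in> I. R i e})"
  using assms
proof (induction I arbitrary: Q rule: finite_induct)
  case empty
  show ?case by (simp add: definable_const)
next
  case (insert k I)
  have "{i \<in> insert k I. R i e} = (if R k e then insert k {i \<in> I. R i e} else {i \<in> I. R i e})" for e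
    by auto
  then have "Q {i \<in> insert k I. R i e} \<longleftrightarrow>
      R k e \<and> Q (insert k {i \<in> I. R i e}) \<or> \<not> R k e \<and> Q {i \<in> I. R i e}" for e
    by simp
  moreover have "definable L M V (\<lambda>e. R k e \<and> Q (insert k {i \<in> I. R i e}) \<or> \<not> R k e \<and> Q {i \<in> I. R i e})"
    using insert.prems by (intro definable_disj definable_conj definable_Not insert.IH) auto
  ultimately show ?case by presburger
qed

lemma definable_ball:
  assumes "finite I" "\<And>i. i \<in> I \<Longrightarrow> definable L M V (R i)"
  shows "definable L M V (\<lambda>e. \<forall>i\<in>I. R i e)"
proof -
  have "(\<forall>i\<in>I. R i e) \<longleftrightarrow> {i \<in> I. R i e} = I" for e
    by auto
  then show ?thesis
    using definable_Collect[OF assms, where Q = "\<lambda>J. J = I"] by simp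
qed

lemma definable_Ex:
  assumes "finite S" "definable L M V R"
  shows "definable L M (V - S) (\<lambda>e. \<exists>e'. (\<forall>v. v \<notin> S \<longrightarrow> e' v = e v) \<and> R e')"
  using assms(1)
proof (induction S rule: finite_induct)
  case empty
  have "(\<forall>v. e' v = e v) \<longleftrightarrow> e' = e" for e' e :: "nat \<Rightarrow> 'c"
    by auto
  then show ?case
    using assms(2) by simp
next
  case (insert u S)
  let ?Q = "\<lambda>e. \<exists>e'. (\<forall>v. v \<notin> S \<longrightarrow> e' v = e v) \<and> R e'"
  obtain \<psi> where \<psi>: "wf_fm L \<psi>" "free_vars \<psi> \<subseteq> V - S" "\<And>e. sat M e \<psi> \<longleftrightarrow> ?Q e"
    using insert.IH unfolding definable_def by blast
  have "(\<exists>a. ?Q (e(u := a))) \<longleftrightarrow> (\<exists>e'. (\<forall>v. v \<notin> insert u S \<longrightarrow> e' v = e v) \<and> R e')" for e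
  proof
    assume "\<exists>e'. (\<forall>v. v \<notin> insert u S \<longrightarrow> e' v = e v) \<and> R e'"
    then obtain e' where "\<forall>v. v \<notin> insert u S \<longrightarrow> e' v = e v" "R e'"
      by blast
    then have "\<forall>v. v \<notin> S \<longrightarrow> e' v = (e(u := e' u)) v" "R e'"
      by auto
    then show "\<exists>a. ?Q (e(u := a))"
      by blast
  next
    assume "\<exists>a. ?Q (e(u := a))"
    then obtain a e' where e': "\<forall>v. v \<notin> S \<longrightarrow> e' v = (e(u := a)) v" "R e'"
      by blast
    then have "\<forall>v. v \<notin> insert u S \<longrightarrow> e' v = e v"
      by simp
    then show "\<exists>e'. (\<forall>v. v \<notin> insert u S \<longrightarrow> e' v = e v) \<and> R e'"
      using e'(2) by blast
  qed
  then show ?case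
    unfolding definable_def using \<psi> by (intro exI[of _ "Exists u \<psi>"]) auto
qed

text \<open>The predicate depends on finitely many variables, so quantifying over all variables from
  \<open>j\<close> on amounts to a finite block of quantifiers.\<close>

lemma definable_extension:
  assumes "definable L M UNIV R"
  shows "definable L M {..<j} (\<lambda>e. \<exists>e'. (\<forall>v<j. e' v = e v) \<and> R e')"
proof -
  obtain V where V: "finite V" "definable L M V R"
    using assms by (rule definable_finite_vars)
  have *: "(\<exists>e'. (\<forall>v. v \<notin> V - {..<j} \<longrightarrow> e' v = e v) \<and> R e') \<longleftrightarrow>
      (\<exists>e'. (\<forall>v<j. e' v = e v) \<and> R e')" for e
  proof
    assume "\<exists>e'. (\<forall>v<j. e' v = e v) \<and> R e'"
    then obtain e' where e': "\<And>v. v < j \<Longrightarrow> e' v = e v" "R e'"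
      by blast
    \<comment> \<open>Outside \<open>V\<close> the values of \<open>e'\<close> do not affect
      \<open>R\<close>; resetting them to those of \<open>e\<close> leaves only finitely many
      differences.\<close>
    let ?e = "\<lambda>v. if v \<in> V then e' v else e v"
    have "R ?e"
      using definable_cong[OF V(2), of e' ?e] e'(2) by simp
    moreover have "\<forall>v. v \<notin> V - {..<j} \<longrightarrow> ?e v = e v"
      using e'(1) by auto
    ultimately show "\<exists>e'. (\<forall>v. v \<notin> V - {..<j} \<longrightarrow> e' v = e v) \<and> R e'"
      by (intro exI[of _ ?e] conjI)
  qed auto
  have "definable L M (V - (V - {..<j})) (\<lambda>e. \<exists>e'. (\<forall>v. v \<notin> V - {..<j} \<longrightarrow> e' v = e v) \<and> R e')"
    using V by (intro definable_Ex) auto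
  then show ?thesis
    unfolding * by (rule definable_mono) auto
qed

section \<open>Compactness for countably many variables\<close>

text \<open>One application of saturation: the parameters are the values of \<open>e\<close> below
  \<open>j\<close>, a finite set and hence smaller than the infinite universe, and \<open>j\<close>
  is the object variable.\<close>

lemma saturated_step:
  fixes M :: "('f, 'r, 'a) fo_structure"
  assumes inf: "infinite (UNIV :: 'a set)" and sat: "saturated L M"
    and def: "\<And>R. R \<in> \<R> \<Longrightarrow> definable L M {..j} R"
    and fin: "\<And>F. finite F \<Longrightarrow> F \<subseteq> \<R> \<Longrightarrow> \<exists>c. \<forall>R\<in>F. R (e(j := c))"
  shows "\<exists>c. \<forall>R\<in>\<R>. R (e(j := c))"
proof -
  \<comment> \<open>\<open>saturated\<close> reserves variable \<open>0\<close> for the object, so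
    \<open>0\<close> and \<open>j\<close> are swapped; as an involution, \<open>f\<close> also
    undoes itself.\<close>
  define f where "f v = (if v = 0 then j else if v = j then 0 else v)" for v
  have ff: "f (f v) = v" and f0: "f 0 = j" for v
    by (auto simp: f_def)
  have upd: "(\<lambda>v. ((\<lambda>v. e (f v))(0 := c)) (f v)) = e(j := c)" for c
    by (auto simp: fun_eq_iff f_def)
  have "\<exists>\<psi>. wf_fm L \<psi> \<and> free_vars \<psi> \<subseteq> f ` {..j} \<and> (\<forall>e. sat M e \<psi> \<longleftrightarrow> R (\<lambda>v. e (f v)))" if "R \<in> \<R>" for R
    using definable_rename[OF def[OF that], of f "f ` {..j}"] by (auto simp: definable_def)
  then obtain \<psi> where \<psi>: "\<And>R. R \<in> \<R> \<Longrightarrow> wf_fm L (\<psi> R)" "\<And>R. R \<in> \<R> \<Longrightarrow> free_vars (\<psi> R) \<subseteq> f ` {..j}"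
      "\<And>R e. R \<in> \<R> \<Longrightarrow> sat M e (\<psi> R) \<longleftrightarrow> R (\<lambda>v. e (f v))"
    by metis
  have sat_\<psi>: "sat M ((\<lambda>v. e (f v))(0 := c)) (\<psi> R) \<longleftrightarrow> R (e(j := c))" if "R \<in> \<R>" for R c
    unfolding \<psi>(3)[OF that] upd ..
  let ?A = "e ` {..<j}"
  let ?p = "(\<lambda>R. (\<psi> R, \<lambda>v. e (f v))) ` \<R>"
  have "|?A| <o |UNIV :: 'a set|"
    using inf by (intro finite_ordLess_infinite) (auto simp: card_of_well_order_on Field_card_of)
  moreover have "\<forall>(\<chi>, e')\<in>?p. wf_fm L \<chi> \<and> e' ` (free_vars \<chi> - {0}) \<subseteq> ?A"
  proof -
    have "f v \<in> {..<j}" if "R \<in> \<R>" "v \<in> free_vars (\<psi> R) - {0}" for R v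
    proof -
      have "f v \<in> {..j}"
        using \<psi>(2) that ff by fastforce
      moreover have "f v \<noteq> j"
        using that ff f0 by (metis DiffE singletonI)
      ultimately show ?thesis by auto
    qed
    then show ?thesis
      using \<psi>(1) by auto
  qed
  moreover have "\<forall>q\<subseteq>?p. finite q \<longrightarrow> (\<exists>c. \<forall>(\<chi>, e')\<in>q. sat M (e'(0 := c)) \<chi>)"
  proof (intro allI impI)
    fix q assume "q \<subseteq> ?p" "finite q"
    then obtain F where F: "F \<subseteq> \<R>" "finite F" "q = (\<lambda>R. (\<psi> R, \<lambda>v. e (f v))) ` F"
      by (meson finite_subset_image)
    then obtain c where "\<forall>R\<in>F. R (e(j := c))"
      using fin by blast
    then have "\<forall>R\<in>F. sat M ((\<lambda>v. e (f v))(0 := c)) (\<psi> R)"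
      using F(1) sat_\<psi> by (simp add: subset_iff del: fun_upd_apply)
    then have "\<forall>(\<chi>, e')\<in>q. sat M (e'(0 := c)) \<chi>"
      unfolding F(3) by simp
    then show "\<exists>c. \<forall>(\<chi>, e')\<in>q. sat M (e'(0 := c)) \<chi>" ..
  qed
  ultimately obtain c where "\<forall>(\<chi>, e')\<in>?p. sat M (e'(0 := c)) \<chi>"
    using sat unfolding saturated_def by meson
  then have "\<forall>R\<in>\<R>. sat M ((\<lambda>v. e (f v))(0 := c)) (\<psi> R)"
    by simp
  then have "\<forall>R\<in>\<R>. R (e(j := c))"
    using sat_\<psi> by simp
  then show ?thesis ..
qed

text \<open>The assignment is built one variable at a time, keeping every finite part of
  \<open>\<R>\<close> satisfiable by some continuation. Each predicate reads finitely many
  variables, so the limit satisfies it.\<close>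

lemma saturated_compactness:
  fixes M :: "('f, 'r, 'a) fo_structure"
  assumes inf: "infinite (UNIV :: 'a set)" and sat: "saturated L M"
    and def: "\<And>R. R \<in> \<R> \<Longrightarrow> definable L M UNIV R"
    and fin: "\<And>F. finite F \<Longrightarrow> F \<subseteq> \<R> \<Longrightarrow> \<exists>e. \<forall>R\<in>F. R e"
  shows "\<exists>e. \<forall>R\<in>\<R>. R e"
proof -
  \<comment> \<open>The variables from \<open>j\<close> on are quantified away, which makes the
    condition definable in the variables already fixed.\<close>
  define agr where "agr j F a \<longleftrightarrow> (\<exists>e. (\<forall>v<j. e v = a v) \<and> (\<forall>R\<in>F. R e))"
    for j :: nat and F and a :: "nat \<Rightarrow> 'a"
  define good where "good j a \<longleftrightarrow> (\<forall>F\<subseteq>\<R>. finite F \<longrightarrow> agr j F a)" for j a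

  have agr_def': "definable L M {..j} (agr (Suc j) F)" if "finite F" "F \<subseteq> \<R>" for j F
  proof -
    have "definable L M UNIV (\<lambda>e. \<forall>R\<in>F. R e)"
    proof (rule definable_ball[where I = F and R = "\<lambda>R. R"])
      show "definable L M UNIV R" if "R \<in> F" for R
        using that \<open>F \<subseteq> \<R>\<close> def by blast
    qed fact
    then have "definable L M {..<Suc j} (agr (Suc j) F)"
      unfolding agr_def by (rule definable_extension)
    then show ?thesis
      by (rule definable_mono) auto
  qed
  have step: "\<exists>c. good (Suc j) (a(j := c))" if "good j a" for j a
  proof -
    let ?\<R> = "{agr (Suc j) F | F. finite F \<and> F \<subseteq> \<R>}"
    have "\<exists>c. \<forall>R\<in>G. R (a(j := c))" if G: "finite G" "G \<subseteq> ?\<R>" for G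
    proof -
      have "?\<R> = agr (Suc j) ` {F. finite F \<and> F \<subseteq> \<R>}"
        by auto
      then obtain \<F> where \<F>: "\<F> \<subseteq> {F. finite F \<and> F \<subseteq> \<R>}" "finite \<F>" "G = agr (Suc j) ` \<F>"
        using G finite_subset_image[of G "agr (Suc j)" "{F. finite F \<and> F \<subseteq> \<R>}"] by auto
      \<comment> \<open>Finitely many conditions \<open>agr (Suc j) F\<close> share a witness: a
        continuation for the union of the sets \<open>F\<close> serves them all.\<close>
      have "finite (\<Union>\<F>)" "\<Union>\<F> \<subseteq> \<R>"
        using \<F> by auto
      then obtain e where e: "\<forall>v<j. e v = a v" "\<forall>R\<in>\<Union>\<F>. R e"
        using \<open>good j a\<close> unfolding good_def agr_def by metis
      have "agr (Suc j) F (a(j := e j))" if "F \<in> \<F>" for F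
        unfolding agr_def using e that by (intro exI[of _ e]) auto
      then show ?thesis
        using \<F> by auto
    qed
    moreover have "definable L M {..j} R" if "R \<in> ?\<R>" for R
      using that agr_def' by auto
    ultimately have "\<exists>c. \<forall>R\<in>?\<R>. R (a(j := c))"
      using saturated_step[OF inf sat] by presburger
    then show ?thesis
      unfolding good_def by blast
  qed
  have "good 0 a" for a
    using fin by (auto simp: good_def agr_def)
  then obtain h where h: "\<And>j. good j (h j)" "\<And>j. \<exists>c. h (Suc j) = (h j)(j := c)"
    using dependent_nat_choice[of good "\<lambda>j a a'. \<exists>c. a' = a(j := c)"] step by metis
  define e where "e v = h (Suc v) v" for v
  have h_eq: "h j v = e v" if "v < j" for j v
    using that
  proof (induction j)
    case (Suc j)
    then show ?case
      using h(2)[of j] by (cases "v = j") (auto simp: e_def)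
  qed simp
  have "R e" if R: "R \<in> \<R>" for R
  proof -
    obtain V where V: "finite V" "definable L M V R"
      using def[OF R] by (rule definable_finite_vars)
    then obtain j where j: "V \<subseteq> {..<j}"
      using finite_nat_iff_bounded by blast
    have "agr j {R} (h j)"
      using h(1)[of j] R by (simp add: good_def)
    then obtain e' where e': "\<forall>v<j. e' v = h j v" "\<forall>Q\<in>{R}. Q e'"
      unfolding agr_def by (elim exE conjE)
    have "e' v = e v" if "v \<in> V" for v
      using that j e'(1) h_eq by auto
    then have "R e' \<longleftrightarrow> R e"
      by (rule definable_cong[OF V(2)])
    then show ?thesis
      using e'(2) by simp
  qed
  then show ?thesis by blast
qed

section \<open>Types as realised words\<close>

lemma assign_nth:
  "distinct vs \<Longrightarrow> length as = length vs \<Longrightarrow> p < length vs \<Longrightarrow> assign vs as (vs ! p) = as ! p"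
  by (simp add: assign_def map_of_zip_nth)

lemma assign_map:
  assumes "v \<in> set vs" "length ns = length vs"
  shows "assign vs (map e ns) v = e (assign vs ns v)"
proof -
  have "map_of (zip vs (map e ns)) v = map_option e (map_of (zip vs ns) v)"
    by (simp add: zip_map2 map_of_map)
  moreover have "map_of (zip vs ns) v \<noteq> None"
    using assms by simp
  ultimately show ?thesis
    by (auto simp: assign_def)
qed

lemma assign_in_set:
  assumes "v \<in> set vs" "length ns = length vs"
  shows "assign vs ns v \<in> set ns"
proof -
  obtain n where "map_of (zip vs ns) v = Some n"
    using assms by (metis map_of_zip_is_Some)
  then show ?thesis
    by (auto simp: assign_def dest!: map_of_SomeD set_zip_rightD)
qed

text \<open>Parameters become variables: the tuple is read from the slots \<open>ns\<close> of an
  assignment, so statements about unknown tuples can enter compactness.\<close>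

lemma definable_sat_assign:
  assumes "wf_fm L \<psi>" "free_vars \<psi> \<subseteq> set zs" "length ns = length zs"
  shows "definable L M (set ns) (\<lambda>e. sat M (assign zs (map e ns)) \<psi>)"
proof -
  have "definable L M (set ns) (\<lambda>e. sat M (\<lambda>v. e (assign zs ns v)) \<psi>)"
    using assms assign_in_set[of _ zs ns]
    by (intro definable_rename[OF definable_sat]) auto
  moreover have "sat M (\<lambda>v. e (assign zs ns v)) \<psi> \<longleftrightarrow> sat M (assign zs (map e ns)) \<psi>" for e
    using assms by (intro sat_cong) (auto simp: assign_map)
  ultimately show ?thesis by simp
qed

text \<open>One assignment codes an infinite sequence of \<open>k\<close>-tuples, entry
  \<open>j\<close> of tuple \<open>i\<close> being the value at \<open>i * k + j\<close>.
  Compactness for assignments thus produces sequences of tuples.\<close>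

definition block :: "nat \<Rightarrow> (nat \<Rightarrow> 'a) \<Rightarrow> nat \<Rightarrow> 'a list" where
  "block k e i = map e [i * k..<i * k + k]"

lemma length_block [simp]: "length (block k e i) = k"
  by (simp add: block_def)

lemma block_eqI:
  assumes "length b = k" "\<And>j. j < k \<Longrightarrow> e (i * k + j) = b ! j"
  shows "block k e i = b"
  using assms by (intro nth_equalityI) (auto simp: block_def)

lemma length_concat_map: "(\<And>i. i \<in> set is \<Longrightarrow> length (g i) = k) \<Longrightarrow>
    length (concat (map g is)) = k * length is"
  by (induction "is") auto

lemma nth_concat_map:
  "(\<And>i. i \<in> set is \<Longrightarrow> length (g i) = k) \<Longrightarrow> p < length is \<Longrightarrow> j < k \<Longrightarrow>
     concat (map g is) ! (p * k + j) = g (is ! p) ! j"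
proof (induction "is" arbitrary: p)
  case (Cons i "is")
  then show ?case
    by (cases p) (auto simp: nth_append algebra_simps)
qed simp

lemma concat_map_block: "concat (map (block k e) is) = map e (concat (map (\<lambda>i. [i * k..<i * k + k]) is))"
  by (induction "is") (auto simp: block_def)

section \<open>Types as finitely satisfiable subsets\<close>

text \<open>If both signs failed, each would have a finite refutation; a tuple satisfying the part
  of both that lies in \<open>p\<close> decides the sign at \<open>a\<close> and so satisfies one of
  them.\<close>

lemma consistent_insert:
  assumes "consistent M \<phi> x y p"
  shows "\<exists>s. consistent M \<phi> x y (insert (s, a) p)"
proof (rule ccontr)
  assume "\<nexists>s. consistent M \<phi> x y (insert (s, a) p)"
  then have "\<forall>s. \<exists>q\<subseteq>insert (s, a) p. finite q \<and>
      \<not> (\<exists>c\<in>tuples (length x). \<forall>(s, a)\<in>q. holds M \<phi> x y c a \<longleftrightarrow> s)"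
    unfolding consistent_def by meson
  then obtain q where q: "\<And>s. q s \<subseteq> insert (s, a) p" "\<And>s. finite (q s)"
      "\<And>s. \<not> (\<exists>c\<in>tuples (length x). \<forall>(s, a)\<in>q s. holds M \<phi> x y c a \<longleftrightarrow> s)"
    by metis
  let ?q = "(q True \<union> q False) \<inter> p"
  obtain c where c: "c \<in> tuples (length x)" "\<forall>(s, a)\<in>?q. holds M \<phi> x y c a \<longleftrightarrow> s"
    using assms q(2) unfolding consistent_def by (metis finite_Int finite_Un inf_le2)
  let ?s = "holds M \<phi> x y c a"
  have "\<forall>(s, a)\<in>q ?s. holds M \<phi> x y c a \<longleftrightarrow> s"
    using q(1)[of ?s] c(2) by (cases ?s) auto
  then show False
    using q(3) c(1) by blast
qed

text \<open>Maximality puts one sign of every instance into the type, so the type is recovered from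
  its positive part and only finite satisfiability remains as a condition.\<close>

lemma types_over_iff:
  "t \<in> types_over M \<phi> x y A \<longleftrightarrow> t \<subseteq> A \<and>
     (\<forall>F\<subseteq>A. finite F \<longrightarrow> (\<exists>c\<in>tuples (length x). \<forall>a\<in>F. holds M \<phi> x y c a \<longleftrightarrow> a \<in> t))"
proof
  assume "t \<in> types_over M \<phi> x y A"
  then obtain p where t: "t = {a \<in> A. (True, a) \<in> p}" and "phi_type M \<phi> x y A p"
    by (auto simp: types_over_def)
  then have p: "p \<subseteq> UNIV \<times> A" "consistent M \<phi> x y p"
      "\<And>q. p \<subseteq> q \<Longrightarrow> q \<subseteq> UNIV \<times> A \<Longrightarrow> consistent M \<phi> x y q \<Longrightarrow> q = p"
    by (auto simp: phi_type_def)
  have mem: "(a \<in> t, a) \<in> p" if a: "a \<in> A" for a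
  proof -
    obtain s where "consistent M \<phi> x y (insert (s, a) p)"
      using consistent_insert[OF p(2)] by blast
    then have "(s, a) \<in> p"
      using p(3)[of "insert (s, a) p"] p(1) a by auto
    then show ?thesis
      using a by (cases s; cases "a \<in> t") (auto simp: t)
  qed
  have "\<exists>c\<in>tuples (length x). \<forall>a\<in>F. holds M \<phi> x y c a \<longleftrightarrow> a \<in> t" if F: "F \<subseteq> A" "finite F" for F
  proof -
    let ?q = "(\<lambda>a. (a \<in> t, a)) ` F"
    have "?q \<subseteq> p" "finite ?q"
      using F mem by auto
    then obtain c where "c \<in> tuples (length x)" "\<forall>(s, a)\<in>?q. holds M \<phi> x y c a \<longleftrightarrow> s"
      using p(2) unfolding consistent_def by meson
    then show ?thesis by auto
  qed
  then show "t \<subseteq> A \<and>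
     (\<forall>F\<subseteq>A. finite F \<longrightarrow> (\<exists>c\<in>tuples (length x). \<forall>a\<in>F. holds M \<phi> x y c a \<longleftrightarrow> a \<in> t))"
    using t by auto
next
  assume "t \<subseteq> A \<and>
     (\<forall>F\<subseteq>A. finite F \<longrightarrow> (\<exists>c\<in>tuples (length x). \<forall>a\<in>F. holds M \<phi> x y c a \<longleftrightarrow> a \<in> t))"
  then have tA: "t \<subseteq> A" and fin: "\<And>F. F \<subseteq> A \<Longrightarrow> finite F \<Longrightarrow>
      \<exists>c\<in>tuples (length x). \<forall>a\<in>F. holds M \<phi> x y c a \<longleftrightarrow> a \<in> t"
    by auto
  let ?p = "(\<lambda>a. (a \<in> t, a)) ` A"
  have "consistent M \<phi> x y ?p"
    unfolding consistent_def
  proof (intro allI impI)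
    fix q assume q: "q \<subseteq> ?p" "finite q"
    then obtain c where "c \<in> tuples (length x)" "\<forall>a\<in>snd ` q. holds M \<phi> x y c a \<longleftrightarrow> a \<in> t"
      using fin[of "snd ` q"] by fastforce
    then show "\<exists>c\<in>tuples (length x). \<forall>(s, a)\<in>q. holds M \<phi> x y c a \<longleftrightarrow> s"
      using q(1) by (intro bexI[of _ c]) force+
  qed
  moreover have "q = ?p" if q: "?p \<subseteq> q" "q \<subseteq> UNIV \<times> A" "consistent M \<phi> x y q" for q
  proof -
    have "s = (a \<in> t)" if "(s, a) \<in> q" for s a
    proof -
      have "{(s, a), (a \<in> t, a)} \<subseteq> q" "finite {(s, a), (a \<in> t, a)}"
        using that q by auto
      then obtain c where "\<forall>(s, a)\<in>{(s, a), (a \<in> t, a)}. holds M \<phi> x y c a \<longleftrightarrow> s"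
        using q(3) unfolding consistent_def by meson
      then show ?thesis by auto
    qed
    then show ?thesis
      using q by force
  qed
  ultimately have "phi_type M \<phi> x y A ?p"
    unfolding phi_type_def by auto
  moreover have "t = {a \<in> A. (True, a) \<in> ?p}"
    using tA by auto
  ultimately show "t \<in> types_over M \<phi> x y A"
    unfolding types_over_def by blast
qed

lemma types_over_finite:
  assumes "finite A"
  shows "types_over M \<phi> x y A = (\<lambda>c. {a \<in> A. holds M \<phi> x y c a}) ` tuples (length x)"
proof (intro set_eqI iffI)
  fix t assume "t \<in> types_over M \<phi> x y A"
  then obtain c where "t \<subseteq> A" "c \<in> tuples (length x)" "\<forall>a\<in>A. holds M \<phi> x y c a \<longleftrightarrow> a \<in> t"
    using assms unfolding types_over_iff by blast
  then show "t \<in> (\<lambda>c. {a \<in> A. holds M \<phi> x y c a}) ` tuples (length x)"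
    by (intro image_eqI[of _ _ c]) auto
next
  fix t assume "t \<in> (\<lambda>c. {a \<in> A. holds M \<phi> x y c a}) ` tuples (length x)"
  then obtain c where "c \<in> tuples (length x)" "t = {a \<in> A. holds M \<phi> x y c a}"
    by blast
  then show "t \<in> types_over M \<phi> x y A"
    unfolding types_over_iff by blast
qed

lemma finite_types_over: "finite A \<Longrightarrow> finite (types_over M \<phi> x y A)"
  by (rule finite_subset[of _ "Pow A"]) (auto simp: types_over_iff)

lemma trace_types_over:
  assumes "\<C> \<subseteq> types_over M \<phi> x y A" "B \<subseteq> A"
  shows "trace \<C> B \<subseteq> types_over M \<phi> x y B"
proof
  fix t assume "t \<in> trace \<C> B"
  then obtain C where C: "C \<in> types_over M \<phi> x y A" "t = C \<inter> B"
    using assms(1) by (auto simp: trace_def)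
  have "\<exists>c\<in>tuples (length x). \<forall>a\<in>F. holds M \<phi> x y c a \<longleftrightarrow> a \<in> t" if F: "F \<subseteq> B" "finite F" for F
  proof -
    obtain c where "c \<in> tuples (length x)" "\<forall>a\<in>F. holds M \<phi> x y c a \<longleftrightarrow> a \<in> C"
      using C(1) F(2) order_trans[OF F(1) assms(2)] unfolding types_over_iff by blast
    then show ?thesis
      using C(2) F by (intro bexI[of _ c]) auto
  qed
  then show "t \<in> types_over M \<phi> x y B"
    using C(2) by (simp add: types_over_iff)
qed

section \<open>Indiscernible sequences and Ramsey's theorem\<close>

lemma indiscernible_take:
  assumes "indiscernible L M k bs"
  shows "indiscernible L M k (take n bs)"
proof -
  have "set (take n bs) \<subseteq> tuples k"
    using assms set_take_subset[of n bs] by (auto simp: indiscernible_def)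
  moreover have "sat M (assign zs (concat (map (\<lambda>i. take n bs ! i) is))) \<psi> \<longleftrightarrow>
         sat M (assign zs (concat (map (\<lambda>j. take n bs ! j) js))) \<psi>"
    if *: "wf_fm L \<psi>" "distinct zs" "free_vars \<psi> \<subseteq> set zs"
        "length js = length is" "length zs = k * length is"
        "sorted_wrt (<) is" "set is \<subseteq> {..<length (take n bs)}"
        "sorted_wrt (<) js" "set js \<subseteq> {..<length (take n bs)}" for \<psi> zs "is" js
  proof -
    have eq: "map (\<lambda>i. take n bs ! i) ns = map (\<lambda>i. bs ! i) ns" if "set ns \<subseteq> {..<length (take n bs)}" for ns
      using that by auto
    have "set is \<subseteq> {..<length bs}" "set js \<subseteq> {..<length bs}"
      using * by auto
    then show ?thesis
      unfolding eq[OF *(7)] eq[OF *(9)] using assms * unfolding indiscernible_def by blast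
  qed
  ultimately show ?thesis
    unfolding indiscernible_def by blast
qed

lemma indiscernible_replicate:
  assumes "b \<in> tuples k"
  shows "indiscernible L M k (replicate n b)"
proof -
  have "map ((!) (replicate n b)) is = replicate (length is) b" if "set is \<subseteq> {..<n}" for "is"
    using that by (intro nth_equalityI) (auto simp: subset_iff)
  then show ?thesis
    using assms by (auto simp: indiscernible_def)
qed

text \<open>Ramsey's theorem is applied once per pair, each time inside the infinite set left
  before. An increasing list is determined by its set of entries, so \<open>g\<close> colours
  \<open>m\<close>-element sets.\<close>

lemma ramsey_finitely_many:
  assumes "finite D"
  shows "\<exists>Y :: nat set. infinite Y \<and> (\<forall>(g, m)\<in>D. \<forall>is js.
     sorted_wrt (<) is \<and> sorted_wrt (<) js \<and> length is = m \<and> length js = m \<and>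
     set is \<subseteq> Y \<and> set js \<subseteq> Y \<longrightarrow> (g is \<longleftrightarrow> (g js :: bool)))"
  using assms
proof (induction D rule: finite_induct)
  case empty
  show ?case by auto
next
  case (insert d D)
  obtain g m where d: "d = (g, m)"
    by (cases d)
  obtain Y where Y: "infinite Y" "\<forall>(g, m)\<in>D. \<forall>is js.
     sorted_wrt (<) is \<and> sorted_wrt (<) js \<and> length is = m \<and> length js = m \<and>
     set is \<subseteq> Y \<and> set js \<subseteq> Y \<longrightarrow> (g is \<longleftrightarrow> g js)"
    using insert.IH by blast
  define f where "f X = (if g (sorted_list_of_set X) then 1 else 0 :: nat)" for X
  then have "\<forall>X. X \<subseteq> Y \<and> finite X \<and> card X = m \<longrightarrow> f X < 2"
    by simp
  from Ramsey[OF Y(1) this] obtain Z t where Z: "Z \<subseteq> Y" "infinite Z"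
      "\<forall>X. X \<subseteq> Z \<and> finite X \<and> card X = m \<longrightarrow> f X = t"
    by (elim exE conjE)
  have *: "f (set is) = t" "sorted_list_of_set (set is) = is"
    if "sorted_wrt (<) is" "length is = m" "set is \<subseteq> Z" for "is"
    using that Z(3) by (simp_all add: strict_sorted_iff distinct_card sorted_list_of_set.idem_if_sorted_distinct)
  have "g is \<longleftrightarrow> g js" if "sorted_wrt (<) is" "sorted_wrt (<) js" "length is = m" "length js = m"
      "set is \<subseteq> Z" "set js \<subseteq> Z" for "is" js
    using *(1)[OF that(1,3,5)] *(1)[OF that(2,4,6)]
    unfolding f_def *(2)[OF that(1,3,5)] *(2)[OF that(2,4,6)] by (auto split: if_splits)
  moreover have "\<forall>(g, m)\<in>D. \<forall>is js.
     sorted_wrt (<) is \<and> sorted_wrt (<) js \<and> length is = m \<and> length js = m \<and>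
     set is \<subseteq> Z \<and> set js \<subseteq> Z \<longrightarrow> (g is \<longleftrightarrow> g js)"
  proof (intro ballI case_prodI2 allI impI, elim conjE)
    fix d' g m and "is" js :: "nat list"
    assume d': "d' \<in> D" "d' = (g, m)" and *: "sorted_wrt (<) is" "sorted_wrt (<) js"
      "length is = m" "length js = m" "set is \<subseteq> Z" "set js \<subseteq> Z"
    show "g is \<longleftrightarrow> g js"
      by (rule bspec[OF Y(2) d'(1), unfolded d'(2) prod.case, rule_format]) (intro conjI * order_trans[OF _ Z(1)])
  qed
  ultimately show ?case
    using Z(2) unfolding d by (intro exI[of _ Z]) simp
qed

section \<open>Words realised along a sequence\<close>

locale monster_formula =
  fixes L :: "('f, 'r) language" and M :: "('f, 'r, 'a) fo_structure"
    and \<phi> :: "('f, 'r) fm" and x y :: "nat list"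
  assumes monster: "monster L M" and partitioned: "partitioned L \<phi> x y"
begin

lemma infinite_universe: "infinite (UNIV :: 'a set)"
  using monster by (simp add: monster_def)

lemma y_pos: "length y > 0"
  using partitioned by (simp add: partitioned_def)

lemmas compactness = saturated_compactness[OF infinite_universe]

text \<open>\<open>b\<close> is defined on all of \<open>nat\<close> so that one notion serves
  finite lists, as \<open>(!) bs\<close>, and infinite sequences.\<close>

definition realized :: "(nat \<Rightarrow> 'a list) \<Rightarrow> bool list \<Rightarrow> bool" where
  "realized b w \<longleftrightarrow> (\<exists>c\<in>tuples (length x). \<forall>i<length w. holds M \<phi> x y c (b i) \<longleftrightarrow> w ! i)"

lemma realized_append: "realized b (w @ v) \<Longrightarrow> realized b w"
  unfolding realized_def by (metis length_append nth_append trans_less_add1)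

lemma realized_cong: "(\<And>i. i < length w \<Longrightarrow> b i = b' i) \<Longrightarrow> realized b w \<longleftrightarrow> realized b' w"
  by (simp add: realized_def)

lemma realized_subword:
  assumes "realized b w" "set is \<subseteq> {..<length w}"
  shows "realized (\<lambda>p. b (is ! p)) (map ((!) w) is)"
proof -
  obtain c where c: "c \<in> tuples (length x)" "\<And>i. i < length w \<Longrightarrow> holds M \<phi> x y c (b i) \<longleftrightarrow> w ! i"
    using assms by (auto simp: realized_def)
  have "is ! p < length w" if "p < length is" for p
    using assms(2) that nth_mem by blast
  then show ?thesis
    using c by (auto simp: realized_def)
qed

text \<open>The word of a type records membership entry by entry. Repeated entries of
  \<open>bs\<close> do no harm: a realised word has equal letters at equal entries.\<close>

lemma card_types_over:
  "card (types_over M \<phi> x y (set bs)) = card {w. length w = length bs \<and> realized ((!) bs) w}"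
proof -
  let ?f = "\<lambda>t. map (\<lambda>b. b \<in> t) bs"
  have "inj_on ?f (types_over M \<phi> x y (set bs))"
    by (rule inj_onI) (auto simp: types_over_iff)
  moreover have "?f ` types_over M \<phi> x y (set bs) = {w. length w = length bs \<and> realized ((!) bs) w}"
  proof (intro set_eqI iffI)
    fix w assume "w \<in> ?f ` types_over M \<phi> x y (set bs)"
    then show "w \<in> {w. length w = length bs \<and> realized ((!) bs) w}"
      by (auto simp: types_over_finite realized_def)
  next
    fix w assume "w \<in> {w. length w = length bs \<and> realized ((!) bs) w}"
    then obtain c where c: "length w = length bs" "c \<in> tuples (length x)"
        "\<And>i. i < length w \<Longrightarrow> holds M \<phi> x y c (bs ! i) \<longleftrightarrow> w ! i"
      by (auto simp: realized_def)
    then have "w = ?f {a \<in> set bs. holds M \<phi> x y c a}"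
      by (intro nth_equalityI) auto
    then show "w \<in> ?f ` types_over M \<phi> x y (set bs)"
      by (rule image_eqI) (use c(2) in \<open>simp add: types_over_finite\<close>)
  qed
  ultimately show ?thesis
    using card_image[of ?f "types_over M \<phi> x y (set bs)"] by presburger
qed

lemma holds_definable:
  assumes "length ns = length x" "length ms = length y"
  shows "definable L M (set ns \<union> set ms) (\<lambda>e. holds M \<phi> x y (map e ns) (map e ms))"
proof -
  have "definable L M (set (ns @ ms)) (\<lambda>e. sat M (assign (x @ y) (map e (ns @ ms))) \<phi>)"
    using assms partitioned by (intro definable_sat_assign) (auto simp: partitioned_def)
  then show ?thesis
    by (simp add: holds_def)
qed

text \<open>The witness \<open>c\<close> is stored in the variables directly above the blocks and
  then quantified away.\<close>

lemma realized_definable: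
  "definable L M {..<length y * length w} (\<lambda>e. realized (block (length y) e) w)"
proof -
  let ?k = "length y" and ?l = "length x"
  let ?n = "?k * length w"
  let ?ns = "[?n..<?n + ?l]"
  let ?H = "\<lambda>i e. holds M \<phi> x y (map e ?ns) (block ?k e i)"
  have lt: "i * ?k + ?k \<le> ?n" if "i < length w" for i
  proof -
    have "Suc i * ?k \<le> length w * ?k"
      using that by (intro mult_right_mono) auto
    then show ?thesis by (simp add: algebra_simps)
  qed
  have H: "definable L M {..<?n + ?l} (\<lambda>e. ?H i e)" if "i < length w" for i
    unfolding block_def
    by (rule definable_mono[OF holds_definable]) (use lt[OF that] in auto)
  have "definable L M {..<?n + ?l} (\<lambda>e. ?H i e \<longleftrightarrow> w ! i)" if "i < length w" for i
    by (cases "w ! i") (use H[OF that] definable_Not[OF H[OF that]] in simp_all)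
  then have "definable L M {..<?n + ?l} (\<lambda>e. \<forall>i\<in>{..<length w}. ?H i e \<longleftrightarrow> w ! i)"
    by (intro definable_ball) auto
  then have "definable L M ({..<?n + ?l} - {?n..<?n + ?l})
     (\<lambda>e. \<exists>e'. (\<forall>v. v \<notin> {?n..<?n + ?l} \<longrightarrow> e' v = e v) \<and> (\<forall>i\<in>{..<length w}. ?H i e' \<longleftrightarrow> w ! i))"
    by (intro definable_Ex) auto
  moreover have "(\<exists>e'. (\<forall>v. v \<notin> {?n..<?n + ?l} \<longrightarrow> e' v = e v) \<and> (\<forall>i\<in>{..<length w}. ?H i e' \<longleftrightarrow> w ! i))
      \<longleftrightarrow> realized (block ?k e) w" for e
  proof
    assume "\<exists>e'. (\<forall>v. v \<notin> {?n..<?n + ?l} \<longrightarrow> e' v = e v) \<and> (\<forall>i\<in>{..<length w}. ?H i e' \<longleftrightarrow> w ! i)"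
    then obtain e' where e': "\<And>v. v \<notin> {?n..<?n + ?l} \<Longrightarrow> e' v = e v"
        "\<And>i. i < length w \<Longrightarrow> ?H i e' \<longleftrightarrow> w ! i"
      by auto
    have "block ?k e' i = block ?k e i" if "i < length w" for i
      unfolding block_def using lt[OF that] by (intro map_cong e'(1)) auto
    then show "realized (block ?k e) w"
      using e'(2) unfolding realized_def
      by (intro bexI[of _ "map e' ?ns"]) (auto simp: tuples_def)
  next
    assume "realized (block ?k e) w"
    then obtain c where c: "length c = ?l" "\<And>i. i < length w \<Longrightarrow> holds M \<phi> x y c (block ?k e i) \<longleftrightarrow> w ! i"
      by (auto simp: realized_def tuples_def)
    define e' where "e' v = (if v \<in> {?n..<?n + ?l} then c ! (v - ?n) else e v)" for v
    have "map e' ?ns = c"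
      using c(1) by (intro nth_equalityI) (auto simp: e'_def)
    moreover have "block ?k e' i = block ?k e i" if "i < length w" for i
      unfolding block_def e'_def using lt[OF that] by (intro map_cong) auto
    ultimately have "\<forall>i\<in>{..<length w}. ?H i e' \<longleftrightarrow> w ! i"
      using c(2) by simp
    then show "\<exists>e'. (\<forall>v. v \<notin> {?n..<?n + ?l} \<longrightarrow> e' v = e v) \<and> (\<forall>i\<in>{..<length w}. ?H i e' \<longleftrightarrow> w ! i)"
      by (intro exI[of _ e']) (simp add: e'_def)
  qed
  ultimately have "definable L M ({..<?n + ?l} - {?n..<?n + ?l}) (\<lambda>e. realized (block ?k e) w)"
    by simp
  then show ?thesis
    by (rule definable_mono) auto
qed

text \<open>That \<open>w\<close> is realised is a first-order condition on \<open>length w\<close>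
  entries, so indiscernibility moves it from the positions \<open>is\<close> to the initial
  segment.\<close>

lemma indiscernible_realized:
  assumes ind: "indiscernible L M (length y) bs"
    and "is": "sorted_wrt (<) is" "set is \<subseteq> {..<length bs}" "length is = length w"
  shows "realized (\<lambda>p. bs ! (is ! p)) w \<longleftrightarrow> realized ((!) bs) w"
proof -
  let ?k = "length y"
  obtain \<psi> where \<psi>: "wf_fm L \<psi>" "free_vars \<psi> \<subseteq> {..<?k * length w}"
      "\<And>e. sat M e \<psi> \<longleftrightarrow> realized (block ?k e) w"
    using realized_definable[of w] unfolding definable_def by blast
  let ?zs = "[0..<?k * length w]" and ?js = "[0..<length w]"
  have len: "length (bs ! i) = ?k" if "i < length bs" for i
    using ind that nth_mem[of i bs] by (auto simp: indiscernible_def tuples_def simp del: nth_mem)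
  have bound: "length w \<le> length bs"
  proof -
    have "card (set is) \<le> card {..<length bs}"
      using "is" by (intro card_mono) auto
    then show ?thesis
      using "is" by (simp add: distinct_card strict_sorted_iff)
  qed
  have *: "sat M (assign ?zs (concat (map ((!) bs) ns))) \<psi> \<longleftrightarrow> realized (\<lambda>p. bs ! (ns ! p)) w"
    if ns: "set ns \<subseteq> {..<length bs}" "length ns = length w" for ns
  proof -
    have len': "\<And>i. i \<in> set ns \<Longrightarrow> length (bs ! i) = ?k"
      using len ns by auto
    have "block ?k (assign ?zs (concat (map ((!) bs) ns))) p = bs ! (ns ! p)" if p: "p < length w" for p
    proof (rule block_eqI)
      show "length (bs ! (ns ! p)) = ?k"
        using p ns by (intro len') auto
      fix j assume j: "j < ?k"
      have "p * ?k + j < Suc p * ?k"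
        using j by simp
      also have "\<dots> \<le> length w * ?k"
        using p by (intro mult_right_mono) auto
      finally have lt: "p * ?k + j < ?k * length w"
        by (simp add: mult.commute)
      have "assign ?zs (concat (map ((!) bs) ns)) (?zs ! (p * ?k + j)) =
          concat (map ((!) bs) ns) ! (p * ?k + j)"
        using lt ns length_concat_map[of ns "(!) bs" ?k, OF len'] by (intro assign_nth) auto
      also have "\<dots> = bs ! (ns ! p) ! j"
        using j p ns len' by (intro nth_concat_map) auto
      finally show "assign ?zs (concat (map ((!) bs) ns)) (p * ?k + j) = bs ! (ns ! p) ! j"
        using lt by simp
    qed
    then show ?thesis
      unfolding \<psi>(3) by (rule realized_cong)
  qed
  have "sat M (assign ?zs (concat (map (\<lambda>i. bs ! i) is))) \<psi> \<longleftrightarrow>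
        sat M (assign ?zs (concat (map (\<lambda>i. bs ! i) ?js))) \<psi>"
    using ind unfolding indiscernible_def
    by (elim conjE allE[of _ \<psi>] allE[of _ ?zs] allE[of _ "is"] allE[of _ ?js] mp)
      (use \<psi> "is" bound in auto)
  moreover have "realized (\<lambda>p. bs ! (?js ! p)) w \<longleftrightarrow> realized ((!) bs) w"
    by (rule realized_cong) simp
  moreover have "set ?js \<subseteq> {..<length bs}" "length ?js = length w"
    using bound by auto
  ultimately show ?thesis
    using *[of "is"] *[of ?js] "is" by simp
qed

section \<open>Bounds for the density on indiscernible sequences\<close>

text \<open>\<open>N choose n\<close> is at least \<open>(N / n) ^ n\<close>, so a bound
  \<open>K * N powr r\<close> with \<open>r < n\<close> fails once \<open>N powr (r - n)\<close> is
  small.\<close>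

lemma VCd_ind_lower:
  assumes long: "\<And>N. \<exists>bs. N \<le> length bs \<and> indiscernible L M (length y) bs \<and>
      choose_le (length bs) n \<le> card (types_over M \<phi> x y (set bs))"
    and "VCd_ind_le L M \<phi> x y r"
  shows "real n \<le> r"
proof (rule ccontr)
  assume "\<not> real n \<le> r"
  then have r: "r - real n < 0"
    by simp
  obtain K :: nat where K: "\<And>bs. bs \<noteq> [] \<Longrightarrow> indiscernible L M (length y) bs \<Longrightarrow>
      real (card (types_over M \<phi> x y (set bs))) < real K * real (length bs) powr r"
    using assms(2) unfolding VCd_ind_le_def by blast
  \<comment> \<open>Chosen so that \<open>K * n ^ n * ?c < 1\<close>; the added \<open>1\<close>
    keeps the denominator positive also for \<open>K = 0\<close>.\<close>
  let ?c = "1 / (real K * real n ^ n + 1)"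
  have "((\<lambda>N. real N powr (r - real n)) \<longlongrightarrow> 0) sequentially"
    using r by (intro tendsto_neg_powr filterlim_real_sequentially)
  moreover have "?c > 0"
    by (intro divide_pos_pos add_nonneg_pos) auto
  ultimately have "eventually (\<lambda>N. real N powr (r - real n) < ?c) sequentially"
    by (rule order_tendstoD(2))
  then obtain N0 where N0: "\<And>N. N \<ge> N0 \<Longrightarrow> real N powr (r - real n) < ?c"
    by (auto simp: eventually_sequentially)
  obtain bs where bs: "max N0 (Suc n) \<le> length bs" "indiscernible L M (length y) bs"
      "choose_le (length bs) n \<le> card (types_over M \<phi> x y (set bs))"
    using long by blast
  let ?N = "length bs"
  have N: "?N > 0" "n \<le> ?N"
    using bs(1) by auto
  have "real ?N ^ n = (real ?N / real n) ^ n * real n ^ n"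
    by (cases "n = 0") (auto simp: power_divide)
  also have "\<dots> \<le> real (?N choose n) * real n ^ n"
    using N(2) by (intro mult_right_mono binomial_ge_n_over_k_pow_k) auto
  also have "\<dots> \<le> real (choose_le ?N n) * real n ^ n"
    by (intro mult_right_mono) (auto simp: choose_le_eq sum_nonneg)
  also have "\<dots> \<le> (real K * real ?N powr r) * real n ^ n"
    using bs(3) K[OF _ bs(2)] N(1) by (intro mult_right_mono) auto
  also have "real ?N powr r = real ?N powr (r - real n) * real ?N ^ n"
    using N(1) by (simp add: powr_diff powr_realpow)
  finally have "1 * real ?N ^ n \<le> (real K * real n ^ n * real ?N powr (r - real n)) * real ?N ^ n"
    by (simp add: mult_ac)
  then have "1 \<le> real K * real n ^ n * real ?N powr (r - real n)"
    using N(1) by (subst (asm) mult_le_cancel_right) auto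
  also have "\<dots> \<le> real K * real n ^ n * ?c"
    using N0[of ?N] bs(1) by (intro mult_left_mono) auto
  also have "\<dots> < 1"
  proof -
    have "X * (1 / (X + 1)) < 1" if "X \<ge> 0" for X :: real
      using that by (simp add: field_simps)
    then show ?thesis
      by (metis of_nat_0_le_iff of_nat_mult of_nat_power)
  qed
  finally show False by simp
qed

text \<open>The automaton may change with \<open>N\<close>; \<open>patterned_sequence\<close>
  removes this dependence.\<close>

definition patterned :: "nat \<Rightarrow> bool" where
  "patterned n \<longleftrightarrow> (\<forall>N. \<exists>bs s. N \<le> length bs \<and> indiscernible L M (length y) bs \<and> length s = Suc n \<and>
     (\<forall>w. length w = length bs \<and> accepts s w \<longrightarrow> realized ((!) bs) w))"

text \<open>Along a constant sequence every tuple realises a constant word, and an automaton with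
  one state accepts only the powers of its letter.\<close>

lemma patterned_0: "patterned 0"
  unfolding patterned_def
proof
  fix N
  let ?b = "replicate (length y) (undefined :: 'a)" and ?c = "replicate (length x) (undefined :: 'a)"
  let ?s = "[holds M \<phi> x y ?c ?b]"
  have nth: "w ! i = a" if "accepts [a] w" "i < length w" for w i a
    using that by (induction w arbitrary: i) (auto simp: nth_Cons split: nat.splits if_splits)
  have "realized ((!) (replicate N ?b)) w" if "length w = N" "accepts ?s w" for w
    using that nth[OF that(2)] unfolding realized_def by (intro bexI[of _ ?c]) (auto simp: tuples_def)
  then show "\<exists>bs s. N \<le> length bs \<and> indiscernible L M (length y) bs \<and> length s = Suc 0 \<and>
     (\<forall>w. length w = length bs \<and> accepts s w \<longrightarrow> realized ((!) bs) w)"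
    by (intro exI[of _ "replicate N ?b"] exI[of _ ?s])
      (auto intro: indiscernible_replicate simp: tuples_def)
qed

lemma patterned_lower:
  assumes "patterned n" "VCd_ind_le L M \<phi> x y r"
  shows "real n \<le> r"
proof (rule VCd_ind_lower[OF _ assms(2)])
  fix N
  obtain bs s where *: "N \<le> length bs" "indiscernible L M (length y) bs" "length s = Suc n"
      "\<And>w. length w = length bs \<Longrightarrow> accepts s w \<Longrightarrow> realized ((!) bs) w"
    using assms(1) unfolding patterned_def by meson
  have "choose_le (length bs) n = card {w. length w = length bs \<and> accepts s w}"
    using *(3) by (simp only: choose_le_eq card_accepts)
  also have "\<dots> \<le> card {w. length w = length bs \<and> realized ((!) bs) w}"
    using *(4) by (intro card_mono finite_words) auto
  finally show "\<exists>bs. N \<le> length bs \<and> indiscernible L M (length y) bs \<and>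
      choose_le (length bs) n \<le> card (types_over M \<phi> x y (set bs))"
    using * by (intro exI[of _ bs]) (simp add: card_types_over)
qed

text \<open>Each automaton with \<open>n + 2\<close> states accepts a word of length
  \<open>N0\<close> that is not realised, and by indiscernibility no realised word contains it as a
  subsequence. A rich word would contain it, so all realised words are poor.\<close>

lemma not_patterned_upper:
  assumes "\<not> patterned (Suc n)"
  shows "VCd_ind_le L M \<phi> x y (real n)"
proof -
  obtain N0 where N0: "\<And>bs s. N0 \<le> length bs \<Longrightarrow> indiscernible L M (length y) bs \<Longrightarrow>
      length s = Suc (Suc n) \<Longrightarrow> \<exists>w. length w = length bs \<and> accepts s w \<and> \<not> realized ((!) bs) w"
    using assms unfolding patterned_def by meson
  \<comment> \<open>\<open>poor_words k m\<close> concerns automata with \<open>m + 1\<close> states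
    and \<open>growth (Suc n)\<close> means degree \<open>n\<close>, so \<open>m = Suc n\<close>
    fits \<open>n + 2\<close> states.\<close>
  obtain C where C: "\<And>N. card (poor_words N0 (Suc n) N0 N0 N) \<le> C * (N + 1) ^ n"
    using poor_words_growth[of "Suc n" N0 N0 N0] by auto
  have long: "card (types_over M \<phi> x y (set bs)) \<le> C * (length bs + 1) ^ n"
    if bs: "indiscernible L M (length y) bs" "N0 \<le> length bs" for bs
  proof -
    have "\<not> subseq (rich_word N0 s) u"
      if u: "length u = length bs" "realized ((!) bs) u" and s: "length s = Suc (Suc n)" for u s
    proof
      assume sub: "subseq (rich_word N0 s) u"
      \<comment> \<open>Passing to the first \<open>N0\<close> entries gives the missing word length
        \<open>N0\<close>, whatever the length of \<open>bs\<close>.\<close>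
      obtain w where w: "length w = N0" "accepts s w" "\<not> realized ((!) (take N0 bs)) w"
        using N0[of "take N0 bs" s] indiscernible_take[OF bs(1)] bs(2) s by auto
      have "subseq w u"
        using subseq_rich_word[OF w(2)] w(1) sub by (meson order_refl subseq_order.order_trans)
      then obtain I where I: "w = nths u I"
        by (auto simp: subseq_conv_nths)
      let ?is = "nths [0..<length u] I"
      have is_set: "set ?is \<subseteq> {..<length u}"
        using set_nths_subset[of "[0..<length u]" I] by auto
      have w': "w = map ((!) u) ?is"
        unfolding I by (simp add: nths_map[symmetric] map_nth)
      have "realized (\<lambda>p. bs ! (?is ! p)) w"
        unfolding w' by (rule realized_subword[OF u(2) is_set])
      moreover have "sorted_wrt (<) ?is"
        by (simp add: strict_sorted_iff sorted_nths)
      moreover have "length ?is = length w"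
        using w' by (metis length_map)
      ultimately have "realized ((!) bs) w"
        using indiscernible_realized[OF bs(1), of ?is w] is_set u(1) by simp
      moreover have "realized ((!) bs) w \<longleftrightarrow> realized ((!) (take N0 bs)) w"
        using w(1) by (intro realized_cong) simp
      ultimately show False
        using w(3) by simp
    qed
    then have "{u. length u = length bs \<and> realized ((!) bs) u} \<subseteq> poor_words N0 (Suc n) N0 N0 (length bs)"
      unfolding poor_words_start by blast
    then have "card {u. length u = length bs \<and> realized ((!) bs) u} \<le>
        card (poor_words N0 (Suc n) N0 N0 (length bs))"
      by (intro card_mono) auto
    then show ?thesis
      using C[of "length bs"] by (simp add: card_types_over)
  qed
  have short: "card (types_over M \<phi> x y (set bs)) \<le> 2 ^ N0" if "length bs < N0" for bs
  proof -
    have "card {w. length w = length bs \<and> realized ((!) bs) w} \<le> card {w :: bool list. length w = length bs}"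
      by (intro card_mono) (use finite_words[of "length bs" "\<lambda>_. True"] in auto)
    also have "\<dots> \<le> 2 ^ N0"
      using that by (simp add: card_words)
    finally show ?thesis
      by (simp add: card_types_over)
  qed
  \<comment> \<open>\<open>2 ^ n\<close> absorbs the passage from \<open>N + 1\<close> to
    \<open>N\<close>, \<open>2 ^ N0\<close> covers the short sequences, and \<open>1\<close> makes
    the inequality strict.\<close>
  let ?K = "C * 2 ^ n + 2 ^ N0 + 1"
  have less: "card (types_over M \<phi> x y (set bs)) < ?K * length bs ^ n"
    if bs: "bs \<noteq> []" "indiscernible L M (length y) bs" for bs
  proof -
    have pos: "length bs ^ n \<ge> 1"
      using bs(1) by (simp add: Suc_le_eq)
    have "card (types_over M \<phi> x y (set bs)) \<le> (C * 2 ^ n + 2 ^ N0) * length bs ^ n"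
    proof (cases "N0 \<le> length bs")
      case True
      have "(length bs + 1) ^ n \<le> (2 * length bs) ^ n"
        using bs(1) by (intro power_mono) (auto simp: Suc_le_eq)
      then have "C * (length bs + 1) ^ n \<le> C * 2 ^ n * length bs ^ n"
        by (simp add: power_mult_distrib mult.assoc)
      then show ?thesis
        using long[OF bs(2) True] unfolding distrib_right by linarith
    next
      case False
      have "2 ^ N0 * 1 \<le> (2 :: nat) ^ N0 * length bs ^ n"
        using pos by (rule mult_le_mono2)
      then show ?thesis
        using short[of bs] False unfolding distrib_right by linarith
    qed
    then show ?thesis
      using pos by (simp add: distrib_right)
  qed
  have "real (card (types_over M \<phi> x y (set bs))) < real ?K * real (length bs) powr real n"
    if "bs \<noteq> []" "indiscernible L M (length y) bs" for bs
  proof -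
    have "real ?K * real (length bs) powr real n = real (?K * length bs ^ n)"
      using that(1) by (subst powr_realpow) (simp_all only: of_nat_mult of_nat_power length_greater_0_conv of_nat_0_less_iff simp_thms)
    then show ?thesis
      using less[OF that] by (simp only: of_nat_less_iff)
  qed
  then show ?thesis
    unfolding VCd_ind_le_def by blast
qed

section \<open>Infinite maximum systems from automata\<close>

text \<open>There are finitely many words of \<open>Suc n\<close> letters, so one of them works for
  arbitrarily large \<open>N\<close>; compactness then merges the finite sequences into an infinite
  one.\<close>

lemma patterned_sequence:
  assumes "patterned n"
  obtains s b where "length s = Suc n" "range b \<subseteq> tuples (length y)"
    "\<forall>w. accepts s w \<longrightarrow> realized b w"
proof -
  let ?k = "length y"
  \<comment> \<open>Monotonicity of \<open>Q\<close> in \<open>N\<close> turns failure of every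
    \<open>s\<close> at its own bound into failure of all of them at the maximum of these
    bounds.\<close>
  define Q where "Q s N \<longleftrightarrow> (\<exists>bs. N \<le> length bs \<and> set bs \<subseteq> tuples ?k \<and>
     (\<forall>w. length w = length bs \<and> accepts s w \<longrightarrow> realized ((!) bs) w))" for s N
  have Q_mono: "Q s N" if "Q s N'" "N \<le> N'" for s N N'
    using that unfolding Q_def by (meson order_trans)
  have ex: "\<exists>s. length s = Suc n \<and> Q s N" for N
    using assms unfolding patterned_def Q_def indiscernible_def by meson
  have "\<exists>s. length s = Suc n \<and> (\<forall>N. Q s N)"
  proof (rule ccontr)
    assume "\<nexists>s. length s = Suc n \<and> (\<forall>N. Q s N)"
    then obtain f where f: "\<And>s. length s = Suc n \<Longrightarrow> \<not> Q s (f s)"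
      by metis
    let ?S = "{s :: bool list. length s = Suc n}"
    have "finite ?S"
      using finite_words[of "Suc n" "\<lambda>_. True"] by simp
    then have "f s \<le> Max (f ` ?S)" if "length s = Suc n" for s
      using that by (intro Max_ge) auto
    then show False
      using ex[of "Max (f ` ?S)"] f Q_mono by blast
  qed
  then obtain s where s: "length s = Suc n" "\<And>N. Q s N"
    by blast
  let ?R = "\<lambda>w e. realized (block ?k e) w"
  have "\<exists>e. \<forall>R\<in>?R ` {w. accepts s w}. R e"
  proof (rule compactness)
    show "saturated L M"
      using monster by (simp add: monster_def)
    show "definable L M UNIV R" if "R \<in> ?R ` {w. accepts s w}" for R
      using that realized_definable definable_mono by blast
    fix F assume "finite F" "F \<subseteq> ?R ` {w. accepts s w}"
    then obtain W where W: "W \<subseteq> {w. accepts s w}" "finite W" "F = ?R ` W"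
      by (meson finite_subset_image)
    obtain N where N: "\<And>w. w \<in> W \<Longrightarrow> length w \<le> N"
      using W(2) by (metis finite_imageI finite_nat_set_iff_bounded_le image_eqI)
    obtain bs where bs: "N \<le> length bs" "set bs \<subseteq> tuples ?k"
        "\<And>w. length w = length bs \<Longrightarrow> accepts s w \<Longrightarrow> realized ((!) bs) w"
      using s(2)[of N] unfolding Q_def by meson
    define e where "e v = bs ! (v div ?k) ! (v mod ?k)" for v
    have "realized (block ?k e) w" if w: "w \<in> W" for w
    proof -
      \<comment> \<open>The words in \<open>W\<close> differ in length: each is padded to the length
        of \<open>bs\<close> with a loop letter, realised there and cut back.\<close>
      obtain a where a: "\<And>m. accepts s (w @ replicate m a)"
        using W(1) w accepts_append_replicate[of s w] by auto
      have "realized ((!) bs) (w @ replicate (length bs - length w) a)"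
        using N[OF w] bs(1) a by (intro bs(3)) auto
      then have "realized ((!) bs) w"
        by (rule realized_append)
      moreover have "block ?k e i = bs ! i" if i: "i < length w" for i
      proof (rule block_eqI)
        have "bs ! i \<in> set bs"
          using i N[OF w] bs(1) by (intro nth_mem) auto
        then show "length (bs ! i) = ?k"
          using bs(2) by (auto simp: tuples_def)
      qed (use y_pos in \<open>simp add: e_def\<close>)
      ultimately show ?thesis
        using realized_cong[of w "block ?k e" "(!) bs"] by simp
    qed
    then have "\<forall>R\<in>F. R e"
      unfolding W(3) by simp
    then show "\<exists>e. \<forall>R\<in>F. R e"
      by (rule exI[of _ e])
  qed
  then obtain e where e: "\<forall>R\<in>?R ` {w. accepts s w}. R e"
    by (rule exE)
  show thesis
  proof (rule that)
    show "length s = Suc n"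
      by (rule s(1))
    show "range (block ?k e) \<subseteq> tuples ?k"
      by (auto simp: tuples_def)
    show "\<forall>w. accepts s w \<longrightarrow> realized (block ?k e) w"
      using e by simp
  qed
qed

lemma infinite_tuples: "infinite (tuples (length y) :: 'a list set)"
proof
  assume "finite (tuples (length y) :: 'a list set)"
  then have "finite (range (\<lambda>a :: 'a. replicate (length y) a))"
    by (rule finite_subset[rotated]) (auto simp: tuples_def)
  moreover have "inj (\<lambda>a :: 'a. replicate (length y) a)"
    using y_pos by (intro injI) (metis nth_replicate)
  ultimately show False
    using infinite_universe finite_imageD by blast
qed

text \<open>A finite part of \<open>range b\<close> lies in an initial segment, where the realised
  prefix of \<open>\<sigma>\<close> supplies the witness.\<close>

lemma sequence_types:
  assumes "inj b" "\<And>N. realized b (map \<sigma> [0..<N])"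
  shows "b ` {i. \<sigma> i} \<in> types_over M \<phi> x y (range b)"
proof -
  have "\<exists>c\<in>tuples (length x). \<forall>a\<in>F. holds M \<phi> x y c a \<longleftrightarrow> a \<in> b ` {i. \<sigma> i}"
    if F: "F \<subseteq> range b" "finite F" for F
  proof -
    obtain I where I: "finite I" "F = b ` I"
      using F finite_subset_image[of F b UNIV] by auto
    then obtain N where N: "I \<subseteq> {..<N}"
      using finite_nat_iff_bounded by blast
    obtain c where "c \<in> tuples (length x)" "\<And>i. i < N \<Longrightarrow> holds M \<phi> x y c (b i) \<longleftrightarrow> \<sigma> i"
      using assms(2)[of N] by (auto simp: realized_def)
    then show ?thesis
      using N assms(1) unfolding I(2) by (intro bexI[of _ c]) (auto simp: inj_image_mem_iff)
  qed
  then show ?thesis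
    by (auto simp: types_over_iff)
qed

text \<open>For \<open>n > 0\<close> the system consists of the infinite words all of whose prefixes
  are accepted. Its traces on finite sets are all accepted words of the right length, by
  \<open>accepts_subseq\<close> and \<open>accepts_fill\<close>.\<close>

lemma patterned_traces:
  assumes "patterned n"
  shows "traces_infinite_maximum M \<phi> x y (ereal (real n))"
proof (cases "n = 0")
  case True
  \<comment> \<open>With one state the sequence obtained may be constant; a single type over all
    tuples is already \<open>0\<close>-maximum.\<close>
  let ?A = "tuples (length y) :: 'a list set"
  let ?c = "replicate (length x) (undefined :: 'a)"
  let ?t = "{a \<in> ?A. holds M \<phi> x y ?c a}"
  have "?t \<in> types_over M \<phi> x y ?A"
    unfolding types_over_iff by (auto simp: tuples_def intro!: exI[of _ ?c])
  moreover have "maximum_on (ereal (real n)) ?A {?t}"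
    using True by (auto simp: maximum_on_def trace_def choose_le_eq)
  ultimately show ?thesis
    unfolding traces_infinite_maximum_def using infinite_tuples by blast
next
  case False
  obtain s b where s: "length s = Suc n" and b: "range b \<subseteq> tuples (length y)"
      "\<forall>w. accepts s w \<longrightarrow> realized b w"
    using assms by (rule patterned_sequence)
  obtain a a' r where s_eq: "s = a # a' # r"
    using s False by (cases s; cases "tl s") auto
  have "b i \<noteq> b j" if "i < j" for i j
  proof
    assume eq: "b i = b j"
    \<comment> \<open>A second state exists since \<open>n > 0\<close>, so one deviation, at
      position \<open>j\<close>, is accepted and separates \<open>j\<close> from every earlier
      position.\<close>
    have "accepts s (replicate j a @ [\<not> a])"
      unfolding s_eq by (induction j) auto
    then obtain c where c: "\<And>p. p < Suc j \<Longrightarrow> holds M \<phi> x y c (b p) \<longleftrightarrow> (replicate j a @ [\<not> a]) ! p"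
      using b(2) unfolding realized_def by fastforce
    show False
      using c[of i] c[of j] that eq by (auto simp: nth_append)
  qed
  then have inj: "inj b"
    by (metis injI linorder_neqE_nat)
  define G where "G = {\<sigma> :: nat \<Rightarrow> bool. \<forall>N. accepts s (map \<sigma> [0..<N])}"
  let ?C = "(\<lambda>\<sigma>. b ` {i. \<sigma> i}) ` G"
  have "?C \<subseteq> types_over M \<phi> x y (range b)"
    using b(2) inj by (auto simp: G_def intro!: sequence_types)
  moreover have "card (trace ?C B) = choose_le (card B) n" if B: "B \<subseteq> range b" "finite B" for B
  proof -
    obtain I where I: "finite I" "B = b ` I"
      using B finite_subset_image[of B b UNIV] by auto
    then obtain N where N: "I \<subseteq> {..<N}"
      using finite_nat_iff_bounded by blast
    let ?xs = "nths [0..<N] I"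
    have xs: "set ?xs = I" "distinct ?xs"
      using N by (auto simp: set_nths intro!: exI)
    then have len: "length ?xs = card I"
      by (metis distinct_card)
    have "trace ?C B = (`) b ` (\<lambda>\<sigma>. {i \<in> I. \<sigma> i}) ` G"
      using inj unfolding trace_def image_image I(2)
      by (intro image_cong refl) (auto dest: injD)
    moreover have "inj_on ((`) b) X" for X
      using inj by (meson inj_image_eq_iff inj_onI)
    ultimately have "card (trace ?C B) = card ((\<lambda>\<sigma>. {i \<in> I. \<sigma> i}) ` G)"
      by (simp add: card_image)
    also have "\<dots> = card ((\<lambda>S. map (\<lambda>i. i \<in> S) ?xs) ` (\<lambda>\<sigma>. {i \<in> I. \<sigma> i}) ` G)"
    proof (rule card_image[symmetric], rule inj_onI)
      fix S S' assume "S \<in> (\<lambda>\<sigma>. {i \<in> I. \<sigma> i}) ` G" "S' \<in> (\<lambda>\<sigma>. {i \<in> I. \<sigma> i}) ` G"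
        and "map (\<lambda>i. i \<in> S) ?xs = map (\<lambda>i. i \<in> S') ?xs"
      moreover from this have "\<forall>i\<in>I. i \<in> S \<longleftrightarrow> i \<in> S'"
        using xs by (simp add: map_eq_conv)
      ultimately show "S = S'" by blast
    qed
    also have "(\<lambda>S. map (\<lambda>i. i \<in> S) ?xs) ` (\<lambda>\<sigma>. {i \<in> I. \<sigma> i}) ` G = (\<lambda>\<sigma>. map \<sigma> ?xs) ` G"
      using xs unfolding image_image by (intro image_cong) auto
    also have "\<dots> = {v. length v = card I \<and> accepts s v}"
    proof (intro set_eqI iffI)
      fix v assume "v \<in> (\<lambda>\<sigma>. map \<sigma> ?xs) ` G"
      then obtain \<sigma> where \<sigma>: "\<sigma> \<in> G" "v = nths (map \<sigma> [0..<N]) I"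
        by (auto simp: nths_map)
      have "subseq v (map \<sigma> [0..<N])"
        unfolding \<sigma>(2) subseq_conv_nths by blast
      then show "v \<in> {v. length v = card I \<and> accepts s v}"
        using \<sigma> len accepts_subseq by (auto simp: G_def nths_map)
    next
      fix v assume "v \<in> {v. length v = card I \<and> accepts s v}"
      then obtain w where w: "length w = N" "accepts s w" "nths w I = v"
        using accepts_fill[of s v "[0..<N]" I] len by auto
      obtain d where d: "\<And>m. accepts s (w @ replicate m d)"
        using accepts_append_replicate[OF w(2)] by blast
      \<comment> \<open>Beyond \<open>N\<close> the letter \<open>d\<close>, which can be appended
        without rejection, keeps all prefixes accepted.\<close>
      define \<sigma> where "\<sigma> i = (if i < N then w ! i else d)" for i
      have "accepts s (map \<sigma> [0..<m])" for m
      proof (rule accepts_subseq)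
        have "map \<sigma> [0..<m] = take m (w @ replicate m d)"
          using w(1) by (intro nth_equalityI) (auto simp: \<sigma>_def nth_append)
        then show "subseq (map \<sigma> [0..<m]) (w @ replicate m d)"
          by (simp only:) (intro prefix_imp_subseq take_is_prefix)
      qed (rule d)
      then have "\<sigma> \<in> G"
        unfolding G_def by blast
      moreover have "map \<sigma> [0..<N] = w"
        using w(1) by (intro nth_equalityI) (auto simp: \<sigma>_def)
      then have "v = map \<sigma> ?xs"
        using w(3) by (simp flip: nths_map)
      ultimately show "v \<in> (\<lambda>\<sigma>. map \<sigma> ?xs) ` G"
        by blast
    qed
    also have "card \<dots> = choose_le (card I) n"
      using s by (simp only: card_accepts choose_le_eq)
    also have "card I = card B"
      using inj I(2) by (metis card_image inj_on_subset subset_UNIV)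
    finally show ?thesis .
  qed
  then have "maximum_on (ereal (real n)) (range b) ?C"
    unfolding maximum_on_def by auto
  moreover have "infinite (range b)"
    using inj by (simp add: finite_image_iff)
  ultimately show ?thesis
    unfolding traces_infinite_maximum_def using b(1) by blast
qed

text \<open>An automaton with \<open>N + 1\<close> states accepts all words of length at most
  \<open>N\<close>, so any finite set of words is realised along one sequence, and compactness
  realises all words at once.\<close>

lemma shattering_traces:
  assumes "\<And>n. patterned n"
  shows "traces_infinite_maximum M \<phi> x y \<infinity>"
proof -
  let ?k = "length y"
  let ?R = "\<lambda>w e. realized (block ?k e) w"
  have "\<exists>e. \<forall>R\<in>range ?R. R e"
  proof (rule compactness)
    show "saturated L M"
      using monster by (simp add: monster_def)
    show "definable L M UNIV R" if "R \<in> range ?R" for R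
      using that realized_definable definable_mono by blast
    fix F assume "finite F" "F \<subseteq> range ?R"
    then obtain W where W: "finite W" "F = ?R ` W"
      by (meson finite_subset_image)
    obtain N where N: "\<And>w. w \<in> W \<Longrightarrow> length w \<le> N"
      using W(1) by (metis finite_imageI finite_nat_set_iff_bounded_le image_eqI)
    obtain s b where s: "length s = Suc N" and b: "range b \<subseteq> tuples ?k" "\<forall>w. accepts s w \<longrightarrow> realized b w"
      using assms by (rule patterned_sequence)
    define e where "e v = b (v div ?k) ! (v mod ?k)" for v
    have "length (b i) = ?k" for i
      using b(1) by (auto simp: tuples_def)
    then have "block ?k e = b"
      by (intro ext block_eqI) (use y_pos in \<open>simp_all add: e_def\<close>)
    then have "\<forall>R\<in>F. R e"
      using b(2) N s accepts_all unfolding W(2) by (auto simp: le_imp_less_Suc)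
    then show "\<exists>e. \<forall>R\<in>F. R e"
      by (rule exI[of _ e])
  qed
  then obtain e where e: "\<forall>R\<in>range ?R. R e"
    by (rule exE)
  let ?b = "block ?k e"
  have real: "realized ?b w" for w
    using e by simp
  have "?b i \<noteq> ?b j" if "i < j" for i j
  proof
    assume eq: "?b i = ?b j"
    \<comment> \<open>The word that is true only at \<open>i\<close> separates \<open>i\<close> from
      \<open>j\<close>.\<close>
    have "realized ?b (map (\<lambda>p. p = i) [0..<Suc j])"
      by (rule real)
    then obtain c where c: "\<forall>p<Suc j. holds M \<phi> x y c (?b p) \<longleftrightarrow> p = i"
      unfolding realized_def by (auto simp del: upt_Suc)
    show False
      using c[rule_format, of i] c[rule_format, of j] that eq by simp
  qed
  then have inj: "inj ?b"
    by (metis injI linorder_neqE_nat)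
  have types: "t \<in> types_over M \<phi> x y (range ?b)" if "t \<subseteq> range ?b" for t
  proof -
    have "t = ?b ` {i. ?b i \<in> t}"
      using that by auto
    then show ?thesis
      using sequence_types[OF inj real, of "\<lambda>i. ?b i \<in> t"] by simp
  qed
  have "maximum_on \<infinity> (range ?b) (Pow (range ?b))"
    unfolding maximum_on_def trace_def by (auto simp: image_iff)
  moreover have "infinite (range ?b)" "range ?b \<subseteq> tuples ?k"
    using inj by (auto simp: finite_image_iff tuples_def)
  moreover have "Pow (range ?b) \<subseteq> types_over M \<phi> x y (range ?b)"
    using types by (auto simp only: Pow_iff)
  ultimately show ?thesis
    unfolding traces_infinite_maximum_def by metis
qed

section \<open>From maximum systems back to indiscernible sequences\<close>

text \<open>Ramsey's theorem inside \<open>A\<close> meets finitely many instances of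
  indiscernibility, compactness meets all of them. A lower bound for the traces is assumed instead
  of equality so that finite \<open>d\<close> and \<open>\<infinity>\<close> are treated
  alike.\<close>

lemma long_indiscernible:
  assumes A: "infinite A" "A \<subseteq> tuples (length y)"
    and C: "\<C> \<subseteq> types_over M \<phi> x y A"
    and card: "\<And>B. B \<subseteq> A \<Longrightarrow> finite B \<Longrightarrow> choose_le (card B) n \<le> card (trace \<C> B)"
  shows "\<exists>bs. N \<le> length bs \<and> indiscernible L M (length y) bs \<and>
      choose_le (length bs) n \<le> card (types_over M \<phi> x y (set bs))"
proof -
  let ?k = "length y"
  obtain b :: "nat \<Rightarrow> 'a list" where b: "inj b" "range b \<subseteq> A"
    using A(1) infinite_countable_subset by blast
  have len_b: "length (b i) = ?k" for i
    using b(2) A(2) by (auto simp: tuples_def)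
  define I where "I = {(\<psi>, zs, is, js). wf_fm L \<psi> \<and> distinct zs \<and> free_vars \<psi> \<subseteq> set zs \<and>
        length js = length is \<and> length zs = ?k * length is \<and>
        sorted_wrt (<) is \<and> set is \<subseteq> {..<N} \<and> sorted_wrt (<) js \<and> set js \<subseteq> {..<N}}"
  define ind where "ind = (\<lambda>(\<psi>, zs, is, js) (e :: nat \<Rightarrow> 'a).
     sat M (assign zs (concat (map (block ?k e) is))) \<psi> \<longleftrightarrow>
     sat M (assign zs (concat (map (block ?k e) js))) \<psi>)"
  \<comment> \<open>Only the number of realised words is prescribed: which words occur depends on
    the subsequence chosen for the finite part.\<close>
  define many where "many e \<longleftrightarrow> choose_le N n \<le> card {w. length w = N \<and> realized (block ?k e) w}"
    for e :: "nat \<Rightarrow> 'a"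
  have "\<exists>e. \<forall>R\<in>insert many (ind ` I). R e"
  proof (rule compactness)
    show "saturated L M"
      using monster by (simp add: monster_def)
    have "definable L M UNIV (ind (\<psi>, zs, is, js))" if *: "(\<psi>, zs, is, js) \<in> I" for \<psi> zs "is" js
    proof -
      have *: "definable L M UNIV (\<lambda>e. sat M (assign zs (concat (map (block ?k e) ns))) \<psi>)"
        if ns: "length ns = length is" for ns
        unfolding concat_map_block
      proof (rule definable_mono[OF definable_sat_assign])
        show "length (concat (map (\<lambda>i. [i * ?k..<i * ?k + ?k]) ns)) = length zs"
          using * ns by (subst length_concat_map[where k = ?k]) (auto simp: I_def)
      qed (use * in \<open>auto simp: I_def\<close>)
      have eq: "ind (\<psi>, zs, is, js) = (\<lambda>e.
          (\<not> sat M (assign zs (concat (map (block ?k e) is))) \<psi> \<or> sat M (assign zs (concat (map (block ?k e) js))) \<psi>) \<and>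
          (sat M (assign zs (concat (map (block ?k e) is))) \<psi> \<or> \<not> sat M (assign zs (concat (map (block ?k e) js))) \<psi>))"
        by (auto simp: ind_def fun_eq_iff)
      have "length js = length is"
        using \<open>_ \<in> I\<close> by (simp add: I_def)
      then show ?thesis
        unfolding eq by (intro definable_conj definable_disj definable_Not *) auto
    qed
    moreover have "definable L M UNIV many"
    proof -
      have "definable L M UNIV (\<lambda>e. choose_le N n \<le>
          card {w \<in> {w. length w = N}. realized (block ?k e) w})"
        using finite_words[of N "\<lambda>_. True"]
        by (intro definable_Collect[where Q = "\<lambda>J. choose_le N n \<le> card J"]
            definable_mono[OF realized_definable]) auto
      then show ?thesis
        by (simp add: many_def[abs_def])
    qed
    ultimately show "definable L M UNIV R" if "R \<in> insert many (ind ` I)" for R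
      using that by auto
    fix F assume F: "finite F" "F \<subseteq> insert many (ind ` I)"
    then have "finite (F - {many})" "F - {many} \<subseteq> ind ` I"
      by auto
    then obtain I0 where I0: "I0 \<subseteq> I" "finite I0" "F - {many} = ind ` I0"
      by (meson finite_subset_image)
    \<comment> \<open>Each formula is a predicate on index lists into \<open>b\<close>; Ramsey's
      theorem makes it constant on increasing lists from \<open>Y\<close>.\<close>
    let ?D = "(\<lambda>(\<psi>, zs, is, js). (\<lambda>ns. sat M (assign zs (concat (map b ns))) \<psi>, length is)) ` I0"
    obtain Y where Y: "infinite Y" "\<forall>(g, m)\<in>?D. \<forall>is js.
       sorted_wrt (<) is \<and> sorted_wrt (<) js \<and> length is = m \<and> length js = m \<and>
       set is \<subseteq> Y \<and> set js \<subseteq> Y \<longrightarrow> (g is \<longleftrightarrow> g js)"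
      using ramsey_finitely_many[of ?D] I0(2) by (meson finite_imageI)
    let ?h = "enumerate Y"
    have h: "strict_mono ?h" "range ?h = Y"
      using Y(1) by (simp_all add: strict_mono_enumerate range_enumerate)
    define e where "e v = b (?h (v div ?k)) ! (v mod ?k)" for v
    have block_e: "block ?k e = (\<lambda>i. b (?h i))"
      by (intro ext block_eqI) (use y_pos len_b in \<open>simp_all add: e_def\<close>)
    have "ind d e" if d: "d \<in> I0" for d
    proof -
      obtain \<psi> zs "is" js where d_eq: "d = (\<psi>, zs, is, js)"
        by (cases d)
      have "(\<psi>, zs, is, js) \<in> I"
        using d d_eq I0(1) by auto
      then have *: "sorted_wrt (<) is" "sorted_wrt (<) js" "length js = length is"
        by (auto simp: I_def)
      have "((\<lambda>ns. sat M (assign zs (concat (map b ns))) \<psi>), length is) \<in> ?D"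
        using d unfolding d_eq by force
      note hom = bspec[OF Y(2) this, unfolded prod.case, rule_format, of "map ?h is" "map ?h js"]
      have sorted: "sorted_wrt (<) (map ?h ns)" if "sorted_wrt (<) ns" for ns
        unfolding sorted_wrt_map using that by (rule sorted_wrt_mono_rel[rotated]) (use h(1) in \<open>simp add: strict_monoD\<close>)
      have "sat M (assign zs (concat (map b (map ?h is)))) \<psi> \<longleftrightarrow>
            sat M (assign zs (concat (map b (map ?h js)))) \<psi>"
        by (rule hom) (use * sorted h(2) in auto)
      then show ?thesis
        by (simp add: ind_def d_eq block_e comp_def)
    qed
    moreover have "many e"
    proof -
      let ?bs = "map (\<lambda>i. b (?h i)) [0..<N]"
      have "inj (\<lambda>i. b (?h i))"
        using inj_compose[OF b(1) strict_mono_imp_inj_on[OF h(1)]] by (simp add: comp_def)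
      \<comment> \<open>The trace bound is applied to a set with exactly \<open>N\<close>
        elements.\<close>
      then have "distinct ?bs"
        by (auto simp: distinct_map intro: inj_on_subset)
      then have "card (set ?bs) = N"
        by (simp only: distinct_card length_map length_upt diff_zero)
      moreover have "set ?bs \<subseteq> A"
        using b(2) by auto
      ultimately have "choose_le N n \<le> card (trace \<C> (set ?bs))"
        using card[of "set ?bs"] by simp
      also have "\<dots> \<le> card (types_over M \<phi> x y (set ?bs))"
        using trace_types_over[OF C \<open>set ?bs \<subseteq> A\<close>] by (intro card_mono finite_types_over) simp_all
      also have "\<dots> = card {w. length w = N \<and> realized ((!) ?bs) w}"
        by (simp add: card_types_over del: set_map)
      also have "{w. length w = N \<and> realized ((!) ?bs) w} = {w. length w = N \<and> realized (block ?k e) w}"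
        unfolding block_e by (intro Collect_cong conj_cong refl realized_cong) simp
      finally show ?thesis
        by (simp add: many_def)
    qed
    ultimately have all: "\<forall>R\<in>insert many (ind ` I0). R e"
      by simp
    have "F \<subseteq> insert many (ind ` I0)"
      unfolding I0(3)[symmetric] by auto
    have "\<forall>R\<in>F. R e"
    proof
      fix R assume "R \<in> F"
      with \<open>F \<subseteq> insert many (ind ` I0)\<close> have "R \<in> insert many (ind ` I0)"
        by (rule subsetD)
      from bspec[OF all this] show "R e" .
    qed
    then show "\<exists>e. \<forall>R\<in>F. R e"
      by (rule exI[of _ e])
  qed
  then obtain e where e: "\<forall>R\<in>insert many (ind ` I). R e"
    by (rule exE)
  define bs where "bs = map (block ?k e) [0..<N]"
  have len: "length bs = N"
    by (simp add: bs_def)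
  have map_bs: "map (\<lambda>i. bs ! i) ns = map (block ?k e) ns" if "set ns \<subseteq> {..<N}" for ns
    using that by (auto simp: bs_def)
  have "indiscernible L M ?k bs"
    unfolding indiscernible_def
  proof (intro conjI allI impI)
    show "set bs \<subseteq> tuples ?k"
      by (auto simp: bs_def tuples_def)
    fix \<psi> zs "is" js
    assume *: "wf_fm L \<psi> \<and> distinct zs \<and> free_vars \<psi> \<subseteq> set zs \<and>
        length js = length is \<and> length zs = ?k * length is \<and>
        sorted_wrt (<) is \<and> set is \<subseteq> {..<length bs} \<and>
        sorted_wrt (<) js \<and> set js \<subseteq> {..<length bs}"
    then have "(\<psi>, zs, is, js) \<in> I"
      by (simp add: I_def len)
    then have "ind (\<psi>, zs, is, js) e"
      using e by simp
    moreover have "set is \<subseteq> {..<N}" "set js \<subseteq> {..<N}"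
      using * len by auto
    ultimately show "sat M (assign zs (concat (map (\<lambda>i. bs ! i) is))) \<psi> \<longleftrightarrow>
         sat M (assign zs (concat (map (\<lambda>j. bs ! j) js))) \<psi>"
      by (simp only: map_bs) (simp add: ind_def)
  qed
  moreover have "choose_le (length bs) n \<le> card (types_over M \<phi> x y (set bs))"
  proof -
    have "{w. length w = N \<and> realized ((!) bs) w} = {w. length w = N \<and> realized (block ?k e) w}"
      by (intro Collect_cong conj_cong refl realized_cong) (simp add: bs_def)
    then show ?thesis
      using e len by (simp add: card_types_over many_def)
  qed
  ultimately show ?thesis
    using len by (intro exI[of _ bs]) simp
qed

section \<open>Comparison of the two densities\<close>

text \<open>A sequence may have more entries than distinct ones, and replacing the smaller number by
  the larger preserves the bound only for exponents that are not negative.\<close>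

lemma VCd_ind_le_if_VCd_le:
  assumes "VCd_le M \<phi> x y r"
  shows "VCd_ind_le L M \<phi> x y (max r 0)"
proof -
  obtain K :: nat where K: "\<And>A. A \<subseteq> tuples (length y) \<Longrightarrow> finite A \<Longrightarrow> A \<noteq> {} \<Longrightarrow>
      real (card (types_over M \<phi> x y A)) < real K * real (card A) powr r"
    using assms unfolding VCd_le_def by blast
  have "real (card (types_over M \<phi> x y (set bs))) < real K * real (length bs) powr max r 0"
    if bs: "bs \<noteq> []" "indiscernible L M (length y) bs" for bs
  proof -
    have "card (set bs) \<ge> 1"
      using bs(1) by (simp add: Suc_le_eq card_gt_0_iff)
    then have "real (card (set bs)) powr r \<le> real (card (set bs)) powr max r 0"
      by (intro powr_mono) auto
    also have "\<dots> \<le> real (length bs) powr max r 0"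
      by (intro powr_mono2) (auto simp: card_length)
    finally have "real K * real (card (set bs)) powr r \<le> real K * real (length bs) powr max r 0"
      by (intro mult_left_mono) auto
    moreover have "set bs \<subseteq> tuples (length y)"
      using bs(2) by (simp add: indiscernible_def)
    ultimately show ?thesis
      using K[of "set bs"] bs(1) by force
  qed
  then show ?thesis
    unfolding VCd_ind_le_def by blast
qed

text \<open>The truncation at \<open>0\<close> comes from \<open>VCd_ind_le_if_VCd_le\<close>; it
  disappears once a maximum system shows that the density is not negative.\<close>

lemma VCd_ind_le_VCd: "VCd_ind L M \<phi> x y \<le> max 0 (VCd M \<phi> x y)"
proof (rule ccontr)
  assume "\<not> ?thesis"
  then have *: "0 < VCd_ind L M \<phi> x y" "VCd M \<phi> x y < VCd_ind L M \<phi> x y"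
    by (simp_all add: not_le)
  then obtain r where r: "VCd_le M \<phi> x y r" "ereal r < VCd_ind L M \<phi> x y"
    by (auto simp: VCd_def Inf_less_iff)
  have "VCd_ind L M \<phi> x y \<le> ereal (max r 0)"
    unfolding VCd_ind_def using VCd_ind_le_if_VCd_le[OF r(1)] by (intro Inf_lower) blast
  then show False
    using r(2) *(1) by (auto simp: max_def zero_ereal_def split: if_splits)
qed

text \<open>The density on indiscernible sequences is a natural number or
  \<open>\<infinity>\<close>: \<open>not_patterned_upper\<close> makes the exponent \<open>n\<close>
  itself admissible, and \<open>patterned_lower\<close> excludes smaller ones.\<close>

lemma VCd_ind_cases:
  obtains "\<And>n. patterned n" "VCd_ind L M \<phi> x y = \<infinity>"
  | n where "patterned n" "VCd_ind L M \<phi> x y = ereal (real n)"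
proof (cases "\<forall>n. patterned n")
  case True
  have "\<not> VCd_ind_le L M \<phi> x y r" for r
  proof
    assume "VCd_ind_le L M \<phi> x y r"
    then have "real n \<le> r" for n
      using True patterned_lower by blast
    then show False
      using reals_Archimedean2[of r] by (meson not_le)
  qed
  then have "VCd_ind L M \<phi> x y = \<infinity>"
    by (simp add: VCd_ind_def top_ereal_def)
  then show ?thesis
    using True that(1) by blast
next
  case False
  \<comment> \<open>\<open>m\<close> is positive by \<open>patterned_0\<close>; its predecessor is
    the density.\<close>
  define m where "m = (LEAST m. \<not> patterned m)"
  have "\<not> patterned m"
    unfolding m_def using False LeastI_ex[of "\<lambda>m. \<not> patterned m"] by blast
  moreover have "patterned i" if "i < m" for i
    using not_less_Least that unfolding m_def by blast
  ultimately obtain n where n: "\<not> patterned (Suc n)" "patterned n"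
    using patterned_0 by (cases m) auto
  have "VCd_ind L M \<phi> x y \<le> ereal (real n)"
    unfolding VCd_ind_def using not_patterned_upper[OF n(1)] by (intro Inf_lower) blast
  moreover have "ereal (real n) \<le> VCd_ind L M \<phi> x y"
    unfolding VCd_ind_def using patterned_lower[OF n(2)] by (intro Inf_greatest) auto
  ultimately show ?thesis
    using that(2) n(2) antisym by blast
qed

text \<open>A \<open>d\<close>-maximum system supplies the trace counts for
  \<open>long_indiscernible\<close>. For \<open>d = \<infinity>\<close> the traces are full power
  sets and reach every bound \<open>choose_le\<close>, which excludes every exponent.\<close>

lemma traces_imp_le_VCd_ind:
  assumes "traces_infinite_maximum M \<phi> x y d"
  shows "0 \<le> d" "d \<le> VCd_ind L M \<phi> x y"
proof -
  obtain A \<C> where A: "infinite A" "A \<subseteq> tuples (length y)" "\<C> \<subseteq> types_over M \<phi> x y A"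
      and max: "maximum_on d A \<C>"
    using assms unfolding traces_infinite_maximum_def by blast
  have lower: "real n \<le> r"
    if card: "\<And>B. B \<subseteq> A \<Longrightarrow> finite B \<Longrightarrow> choose_le (card B) n \<le> card (trace \<C> B)"
      and r: "VCd_ind_le L M \<phi> x y r" for n r
    using long_indiscernible[OF A card] by (rule VCd_ind_lower) (use r in auto)
  have "0 \<le> d \<and> d \<le> VCd_ind L M \<phi> x y"
  proof (cases "d = \<infinity>")
    case True
    then have "trace \<C> B = Pow B" if "B \<subseteq> A" "finite B" for B
      using max that by (auto simp: maximum_on_def)
    moreover have "choose_le N n \<le> 2 ^ N" for N n
    proof -
      have "(\<Sum>i<Suc n. N choose i) \<le> (\<Sum>i<Suc (max n N). N choose i)"
        by (intro sum_mono2) auto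
      also have "\<dots> = 2 ^ N"
        using choose_le_eq[of N "max n N"] by (simp add: choose_le_def)
      finally show ?thesis
        by (simp add: choose_le_eq)
    qed
    ultimately have "real n \<le> r" if "VCd_ind_le L M \<phi> x y r" for n r
      using that by (intro lower) (auto simp: card_Pow)
    then have "\<not> VCd_ind_le L M \<phi> x y r" for r
      using reals_Archimedean2[of r] by (meson not_le)
    then show ?thesis
      using True by (simp add: VCd_ind_def top_ereal_def)
  next
    case False
    then obtain n where n: "d = ereal (real n)"
        "\<And>B. B \<subseteq> A \<Longrightarrow> finite B \<Longrightarrow> card (trace \<C> B) = choose_le (card B) n"
      using max by (auto simp: maximum_on_def)
    then show ?thesis
      unfolding VCd_ind_def using lower[of n] by (auto intro!: Inf_greatest)
  qed
  then show "0 \<le> d" "d \<le> VCd_ind L M \<phi> x y"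
    by auto
qed

end

theorem corollary3p4:
  fixes L :: "('f, 'r) language"
    and T :: "('f, 'r) fm set"
    and M :: "('f, 'r, 'a) fo_structure"
    and \<phi> :: "('f, 'r) fm"
    and x y :: "nat list"
  assumes "complete_theory L T"
    and "models M T"
    and "monster L M"
    and "partitioned L \<phi> x y"
  shows "VCd M \<phi> x y = VCd_ind L M \<phi> x y \<longleftrightarrow>
         traces_infinite_maximum M \<phi> x y (VCd M \<phi> x y)"
proof -
  interpret monster_formula L M \<phi> x y
    using assms by unfold_locales
  show ?thesis
  proof
    assume eq: "VCd M \<phi> x y = VCd_ind L M \<phi> x y"
    show "traces_infinite_maximum M \<phi> x y (VCd M \<phi> x y)"
    proof (cases rule: VCd_ind_cases)
      case 1
      then show ?thesis
        using eq shattering_traces by simp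
    next
      case (2 n)
      then show ?thesis
        using eq patterned_traces by simp
    qed
  next
    assume "traces_infinite_maximum M \<phi> x y (VCd M \<phi> x y)"
    then show "VCd M \<phi> x y = VCd_ind L M \<phi> x y"
      \<comment> \<open>With \<open>d\<close> the density,
        \<open>d \<le> VCd_ind \<le> max 0 d\<close>, and \<open>0 \<le> d\<close> collapses the
        chain.\<close>
      using traces_imp_le_VCd_ind VCd_ind_le_VCd by (metis antisym max_absorb2)
  qed
qed

end
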